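(* Let $r\geq 2$, $n>r^{8}$ and $0<\alpha<\frac{1}{36r^{8}}$. If a graph $G$ of order $n$ satisfies $$e(G)>\left(\frac{r-1}{2r}-\alpha\right)n^{2},$$ then either $$js^{(2,r+1,2)}(G)>\left(1-\frac{1}{r^{3}}\right)\frac{n^{r-1}}{r^{r+5}},$$ or $G$ contains an induced subgraph $G_0$ with chromatic number at most $r$, of order at least $(1-2\sqrt{\alpha})n$, and with minimum degree $$\delta(G_0)>\left(1-\frac1r-6\sqrt{\alpha}\right)n.$$
   Context: All graphs are finite and simple; $e(G)$ is the number of edges and $\delta(G)$ the minimum degree. For an integer $r\geq 2$, $js^{(2,r+1,2)}(G)$ is the maximum, over all edges $uv$ of $G$, of the number of $(r+1)$-cliques of $G$ containing both $u$ and $v$ (and $0$ if $G$ has no edges). *)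

theory Defs
  imports Complex_Main
begin

definition simple_graph :: "'a set \<Rightarrow> ('a \<Rightarrow> 'a \<Rightarrow> bool) \<Rightarrow> bool" where
  "simple_graph V E \<longleftrightarrow> finite V \<and> (\<forall>u v. E u v \<longrightarrow> E v u) \<and> (\<forall>v. \<not> E v v)
     \<and> (\<forall>u v. E u v \<longrightarrow> u \<in> V \<and> v \<in> V)"

definition edges :: "'a set \<Rightarrow> ('a \<Rightarrow> 'a \<Rightarrow> bool) \<Rightarrow> 'a set set" where
  "edges V E = {{u, v} | u v. u \<in> V \<and> v \<in> V \<and> E u v}"

definition num_edges :: "'a set \<Rightarrow> ('a \<Rightarrow> 'a \<Rightarrow> bool) \<Rightarrow> nat" where
  "num_edges V E = card (edges V E)"

definition is_clique :: "'a set \<Rightarrow> ('a \<Rightarrow> 'a \<Rightarrow> bool) \<Rightarrow> 'a set \<Rightarrow> bool" where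
  "is_clique V E K \<longleftrightarrow> K \<subseteq> V \<and> (\<forall>x\<in>K. \<forall>y\<in>K. x \<noteq> y \<longrightarrow> E x y)"

definition cliques_through :: "'a set \<Rightarrow> ('a \<Rightarrow> 'a \<Rightarrow> bool) \<Rightarrow> nat \<Rightarrow> 'a \<Rightarrow> 'a \<Rightarrow> nat" where
  "cliques_through V E k u v = card {K. is_clique V E K \<and> card K = k \<and> u \<in> K \<and> v \<in> K}"

definition js :: "'a set \<Rightarrow> ('a \<Rightarrow> 'a \<Rightarrow> bool) \<Rightarrow> nat \<Rightarrow> nat" where
  "js V E r = Max (insert 0 {cliques_through V E (r + 1) u v | u v. u \<in> V \<and> v \<in> V \<and> E u v})"

definition proper_colouring :: "'a set \<Rightarrow> ('a \<Rightarrow> 'a \<Rightarrow> bool) \<Rightarrow> nat \<Rightarrow> ('a \<Rightarrow> nat) \<Rightarrow> bool" where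
  "proper_colouring S E k f \<longleftrightarrow> (\<forall>v\<in>S. f v < k) \<and> (\<forall>u\<in>S. \<forall>v\<in>S. E u v \<longrightarrow> f u \<noteq> f v)"

definition chromatic_number :: "'a set \<Rightarrow> ('a \<Rightarrow> 'a \<Rightarrow> bool) \<Rightarrow> nat" where
  "chromatic_number S E = (LEAST k. \<exists>f. proper_colouring S E k f)"

definition degree_in :: "'a set \<Rightarrow> ('a \<Rightarrow> 'a \<Rightarrow> bool) \<Rightarrow> 'a \<Rightarrow> nat" where
  "degree_in S E v = card {u \<in> S. E v u}"

definition min_degree :: "'a set \<Rightarrow> ('a \<Rightarrow> 'a \<Rightarrow> bool) \<Rightarrow> nat" where
  "min_degree S E = Min ((degree_in S E) ` S)"

end

theory Submission
  imports Defs
begin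

text \<open>
  Let \<open>M\<close> be the set of vertices of degree at most \<open>(1 - 1/r - 4 sqrt \<alpha>) n\<close>. If \<open>M\<close> has at most
  \<open>2 n sqrt \<alpha>\<close> elements, then \<open>G - M\<close> has the required order and minimum degree. If it contains
  a \<open>K\<^sub>r\<^sub>+\<^sub>1\<close>, the minimum degree forces an edge of this clique to have many common neighbours, and
  extending that edge greedily gives many \<open>(r+1)\<close>-cliques; otherwise \<open>G - M\<close> is \<open>r\<close>-partite, by a
  weak form of the Andrasfai-Erdos-Sos theorem. If \<open>M\<close> is larger, removing about \<open>n sqrt \<alpha>\<close> of its
  vertices leaves more than \<open>(r-1)/(2r) m\<^sup>2\<close> edges on the remaining \<open>m\<close> vertices. Then peel off
  vertices of degree below \<open>(1 - 1/r - 1/r\<^sup>4) i\<close>, where \<open>i\<close> is the current order. If this stops early,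
  the remaining graph has large minimum degree and too many edges to be \<open>r\<close>-partite, so it contains
  a \<open>K\<^sub>r\<^sub>+\<^sub>1\<close>; if it goes on, the density rises so far above the Turan density that the Moon-Moser
  inequalities give many \<open>(r+1)\<close>-cliques through an average edge.
  The argument degenerates when \<open>n sqrt \<alpha> < 1/2\<close>, where integrality is used instead.
\<close>

section \<open>Common neighbourhoods and clique counts\<close>

definition common_nbrs :: "'a set \<Rightarrow> ('a \<Rightarrow> 'a \<Rightarrow> bool) \<Rightarrow> 'a set \<Rightarrow> 'a set" where
  "common_nbrs S E B = {x \<in> S. \<forall>b\<in>B. E b x}"

text \<open>The prescribed subset lets the same counting identities serve for all cliques
  (\<open>B0 = {}\<close>) and for the cliques through an edge (\<open>B0 = {u, v}\<close>).\<close>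

definition cliques_over :: "'a set \<Rightarrow> ('a \<Rightarrow> 'a \<Rightarrow> bool) \<Rightarrow> nat \<Rightarrow> 'a set \<Rightarrow> 'a set set" where
  "cliques_over S E k B0 = {K. is_clique S E K \<and> card K = k \<and> B0 \<subseteq> K}"

text \<open>Twice the number of edges; in these terms the Turan density is
  \<open>1 - 1/r\<close>.\<close>

definition degree_sum :: "'a set \<Rightarrow> ('a \<Rightarrow> 'a \<Rightarrow> bool) \<Rightarrow> nat" where
  "degree_sum S E = (\<Sum>v\<in>S. degree_in S E v)"

lemma finite_common_nbrs [simp]: "finite S \<Longrightarrow> finite (common_nbrs S E B)"
  by (simp add: common_nbrs_def)

lemma finite_cliques_over [simp]: "finite S \<Longrightarrow> finite (cliques_over S E k B0)"
  by (rule finite_subset[of _ "Pow S"]) (auto simp: cliques_over_def is_clique_def)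

lemma cliques_through_eq: "cliques_through S E k u v = card (cliques_over S E k {u, v})"
  by (simp add: cliques_through_def cliques_over_def)

lemma degree_in_eq: "degree_in S E v = card (common_nbrs S E {v})"
  by (simp add: degree_in_def common_nbrs_def)

lemma is_clique_finite: "is_clique S E K \<Longrightarrow> finite S \<Longrightarrow> finite K"
  by (auto simp: is_clique_def intro: finite_subset)

lemma cliques_through_mono:
  assumes "S \<subseteq> V" "finite V"
  shows "cliques_through S E k u v \<le> cliques_through V E k u v"
  unfolding cliques_through_eq
  by (rule card_mono) (use assms in \<open>auto simp: cliques_over_def is_clique_def\<close>)

text \<open>
  Here \<open>\<tau> s\<close> is the number of \<open>s\<close>-cliques through a fixed edge, or the average of this number
  over all edges; the same recursion holds for both.
\<close>

lemma iterated_extension_bound: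
  fixes \<tau> :: "nat \<Rightarrow> real" and N \<gamma> :: real
  assumes r: "2 \<le> r" and N: "0 \<le> N" and \<gamma>: "0 \<le> \<gamma>" and base: "1 \<le> \<tau> 2"
    and step: "\<And>s. 2 \<le> s \<Longrightarrow> s < r \<Longrightarrow> \<tau> s * ((1 - real s / real r) * N) \<le> \<tau> (Suc s) * (real s - 1)"
    and last: "\<tau> r * (\<gamma> * (real r - 1) * N) \<le> \<tau> (Suc r) * (real r - 1)"
  shows "\<gamma> * N ^ (r - 1) / real r ^ (r - 2) \<le> \<tau> (Suc r)"
proof -
  \<comment> \<open>Going from \<open>s = m + 2\<close> to \<open>s + 1\<close> contributes the
    factor \<open>(r - 2 - m) / (m + 1) * N / r\<close>. The product of these is a binomial
    coefficient times a power of \<open>N / r\<close>, and the coefficient is 1 at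
    \<open>m = r - 2\<close>.\<close>
  have ind: "real ((r - 2) choose m) * (N / real r) ^ m \<le> \<tau> (m + 2)" if "m \<le> r - 2" for m
    using that
  proof (induction m)
    case 0
    then show ?case using base by (simp add: numeral_2_eq_2)
  next
    case (Suc m)
    have m: "m + 2 < r" using Suc.prems by simp
    have "Suc m * ((r - 2) choose Suc m) = (r - 2 - m) * ((r - 2) choose m)"
      using binomial_absorption[of m "r - 2"] binomial_absorb_comp[of "r - 2" m] by simp
    hence "real (Suc m) * real ((r - 2) choose Suc m) = real (r - 2 - m) * real ((r - 2) choose m)"
      by (metis of_nat_mult)
    hence bin: "real (Suc m) * real ((r - 2) choose Suc m)
        = (real r - real (m + 2)) * real ((r - 2) choose m)"
      using m by (simp add: of_nat_diff)
    have "real (Suc m) * (real ((r - 2) choose Suc m) * (N / real r) ^ Suc m)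
       = (real (Suc m) * real ((r - 2) choose Suc m)) * ((N / real r) ^ m * (N / real r))"
      by simp
    also have "\<dots> = (real ((r - 2) choose m) * (N / real r) ^ m) * ((1 - real (m + 2) / real r) * N)"
      unfolding bin using r by (simp add: field_simps)
    also have "\<dots> \<le> \<tau> (m + 2) * ((1 - real (m + 2) / real r) * N)"
      by (rule mult_right_mono) (use Suc m N in auto)
    also have "\<dots> \<le> \<tau> (Suc (m + 2)) * (real (m + 2) - 1)"
      using step[of "m + 2"] m by simp
    finally have "real (Suc m) * (real ((r - 2) choose Suc m) * (N / real r) ^ Suc m)
        \<le> real (Suc m) * \<tau> (Suc m + 2)"
      by (simp add: mult.commute)
    thus ?case by (rule mult_left_le_imp_le) simp
  qed
  have "(N / real r) ^ (r - 2) \<le> \<tau> r"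
    using ind[of "r - 2"] r by (simp add: numeral_2_eq_2 Suc_diff_Suc)
  \<comment> \<open>At \<open>s = r\<close> the factor \<open>1 - s / r\<close> vanishes, so the
    last extension rests on the separate gain \<open>\<gamma>\<close>.\<close>
  hence "(N / real r) ^ (r - 2) * (\<gamma> * (real r - 1) * N) \<le> \<tau> r * (\<gamma> * (real r - 1) * N)"
    by (rule mult_right_mono) (use N \<gamma> r in auto)
  also note last
  finally have "((N / real r) ^ (r - 2) * \<gamma> * N) * (real r - 1) \<le> \<tau> (Suc r) * (real r - 1)"
    by (simp add: algebra_simps)
  hence *: "(N / real r) ^ (r - 2) * \<gamma> * N \<le> \<tau> (Suc r)"
    by (rule mult_right_le_imp_le) (use r in auto)
  obtain q where q: "r = q + 2" using r by (metis le_iff_add add.commute)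
  show ?thesis using * unfolding q by (simp add: power_divide algebra_simps)
qed

locale ugraph =
  fixes E :: "'a \<Rightarrow> 'a \<Rightarrow> bool"
  assumes sym: "E u v \<Longrightarrow> E v u" and irrefl: "\<not> E v v"
begin

subsection \<open>Counting cliques\<close>

text \<open>Double counting: deleting a vertex \<open>x\<close> outside \<open>B0\<close> from
  \<open>A\<close>, and adding a common neighbour \<open>x\<close> to \<open>B\<close>, are mutually
  inverse on pairs.\<close>

lemma sum_clique_extensions:
  assumes fin: "finite S"
  shows "(\<Sum>A\<in>cliques_over S E (Suc k) B0. \<Sum>x\<in>A - B0. f (A - {x}))
    = (\<Sum>B\<in>cliques_over S E k B0. \<Sum>x\<in>common_nbrs S E B. f B)"
proof -
  have finA: "finite A" if "A \<in> cliques_over S E j B0" for A j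
    using that is_clique_finite[OF _ fin] by (auto simp: cliques_over_def)
  have "(\<Sum>A\<in>cliques_over S E (Suc k) B0. \<Sum>x\<in>A - B0. f (A - {x}))
    = (\<Sum>(A, x)\<in>Sigma (cliques_over S E (Suc k) B0) (\<lambda>A. A - B0). f (A - {x}))"
    by (rule sum.Sigma) (use fin finA in auto)
  also have "\<dots> = (\<Sum>(B, x)\<in>Sigma (cliques_over S E k B0) (common_nbrs S E). f B)"
  proof (rule sum.reindex_bij_witness[where i = "\<lambda>(B, x). (insert x B, x)"
        and j = "\<lambda>(A, x). (A - {x}, x)"], goal_cases)
    case (2 a)
    then obtain A x where a: "a = (A, x)" "A \<in> cliques_over S E (Suc k) B0" "x \<in> A - B0" by auto
    then show ?case using finA[OF a(2)]
      by (auto simp: cliques_over_def is_clique_def common_nbrs_def)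
  next
    case (4 b)
    then obtain B x where b: "b = (B, x)" "B \<in> cliques_over S E k B0" "x \<in> common_nbrs S E B" by auto
    have "x \<notin> B" using b irrefl by (auto simp: common_nbrs_def)
    then show ?case using finA[OF b(2)] b
      by (auto simp: cliques_over_def is_clique_def common_nbrs_def intro: sym)
  next
    case (3 b)
    then show ?case using irrefl by (force simp: common_nbrs_def)
  qed (auto)
  also have "\<dots> = (\<Sum>B\<in>cliques_over S E k B0. \<Sum>x\<in>common_nbrs S E B. f B)"
    by (rule sum.Sigma[symmetric]) (use fin in auto)
  finally show ?thesis .
qed

text \<open>The case of constant weight 1: a clique on \<open>k + 1\<close> vertices over
  \<open>B0\<close> has \<open>k + 1 - b\<close> vertices that can be deleted.\<close>

lemma sum_card_common_nbrs:
  assumes fin: "finite S" and B0: "finite B0" "card B0 = b"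
  shows "(\<Sum>B\<in>cliques_over S E k B0. real (card (common_nbrs S E B)))
    = real (card (cliques_over S E (Suc k) B0)) * (real (Suc k) - real b)"
proof -
  have "real (card (A - B0)) = real (Suc k) - real b" if "A \<in> cliques_over S E (Suc k) B0" for A
    using that B0 card_mono[of A B0] is_clique_finite[OF _ fin, of E A]
    by (auto simp: cliques_over_def card_Diff_subset of_nat_diff)
  thus ?thesis using sum_clique_extensions[OF fin, where f = "\<lambda>_. 1 :: real" and k = k and ?B0.0 = B0]
    by simp
qed

lemma singletons_eq_cliques: "finite S \<Longrightarrow> cliques_over S E 1 {} = (\<lambda>v. {v}) ` S"
  by (auto simp: cliques_over_def is_clique_def card_1_singleton_iff)

lemma degree_sum_eq_cliques:
  assumes "finite S"
  shows "real (degree_sum S E) = 2 * real (card (cliques_over S E 2 {}))"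
proof -
  have "(\<Sum>B\<in>cliques_over S E 1 {}. real (card (common_nbrs S E B))) = real (degree_sum S E)"
    unfolding singletons_eq_cliques[OF assms] degree_sum_def degree_in_eq
    by (subst sum.reindex) auto
  thus ?thesis using sum_card_common_nbrs[OF assms, of "{}" 0 1] by (simp add: numeral_2_eq_2)
qed

lemma degree_sum_eq_edges:
  assumes "finite S"
  shows "real (degree_sum S E) = 2 * real (num_edges S E)"
proof -
  have "edges S E = cliques_over S E 2 {}"
    using sym irrefl by (fastforce simp: edges_def cliques_over_def is_clique_def card_2_iff)
  thus ?thesis by (simp add: degree_sum_eq_cliques[OF assms] num_edges_def)
qed

text \<open>A vertex of \<open>S\<close> counts among its own non-neighbours, so no correction by
  one appears.\<close>

lemma card_non_nbrs:
  assumes "finite S"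
  shows "real (card {z \<in> S. \<not> E x z}) = real (card S) - real (degree_in S E x)"
proof -
  have "card S = degree_in S E x + card {z \<in> S. \<not> E x z}"
    unfolding degree_in_def
    by (subst card_Un_disjoint[symmetric]) (use assms in \<open>auto intro: arg_cong[where f = card]\<close>)
  thus ?thesis by simp
qed

text \<open>Union bound over the non-neighbours of the members of \<open>B\<close>, proved by
  inclusion-exclusion one vertex at a time.\<close>

lemma card_common_nbrs_ge:
  assumes fin: "finite S" and "finite B"
  shows "real (card S) - (\<Sum>b\<in>B. real (card S) - real (degree_in S E b)) \<le> real (card (common_nbrs S E B))"
  using \<open>finite B\<close>
proof (induction B)
  case empty
  then show ?case by (simp add: common_nbrs_def)
next
  case (insert b B)
  have "card (common_nbrs S E B) + card (common_nbrs S E {b})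
      = card (common_nbrs S E B \<union> common_nbrs S E {b}) + card (common_nbrs S E B \<inter> common_nbrs S E {b})"
    by (rule card_Un_Int) (use fin in auto)
  moreover have "common_nbrs S E B \<inter> common_nbrs S E {b} = common_nbrs S E (insert b B)"
    by (auto simp: common_nbrs_def)
  moreover have "card (common_nbrs S E B \<union> common_nbrs S E {b}) \<le> card S"
    by (rule card_mono) (use fin in \<open>auto simp: common_nbrs_def\<close>)
  ultimately have "real (card (common_nbrs S E B)) + real (degree_in S E b)
      \<le> real (card S) + real (card (common_nbrs S E (insert b B)))"
    unfolding degree_in_eq by (metis add_le_cancel_right of_nat_add of_nat_le_iff)
  then show ?case using insert by simp
qed

text \<open>Averaging over ordered adjacent pairs: there are \<open>degree_sum S E\<close> of them,
  and each clique on \<open>k\<close> vertices is counted for \<open>k (k - 1)\<close>.\<close>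

lemma exists_frequent_edge:
  assumes fin: "finite S" and e: "0 < degree_sum S E"
  shows "\<exists>u\<in>S. \<exists>v\<in>S. E u v \<and>
    real k * (real k - 1) * real (card (cliques_over S E k {})) / real (degree_sum S E)
      \<le> real (cliques_through S E k u v)"
proof (rule ccontr)
  let ?P = "Sigma S (\<lambda>u. {v \<in> S. E u v})"
  let ?c = "real k * (real k - 1) * real (card (cliques_over S E k {})) / real (degree_sum S E)"
  assume "\<not> ?thesis"
  hence less: "real (cliques_through S E k u v) < ?c" if "u \<in> S" "v \<in> S" "E u v" for u v
    using that by force
  have finP: "finite ?P" using fin by auto
  have cP: "card ?P = degree_sum S E"
    using fin by (simp add: degree_sum_def degree_in_def)
  have ne: "?P \<noteq> {}" using cP e by auto
  have "real (degree_sum S E) * ?c = real k * (real k - 1) * real (card (cliques_over S E k {}))"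
    using e by simp
  also have "\<dots> = (\<Sum>K\<in>cliques_over S E k {}. real (card {p \<in> ?P. fst p \<in> K \<and> snd p \<in> K}))"
  proof -
    have "real (card {p \<in> ?P. fst p \<in> K \<and> snd p \<in> K}) = real k * (real k - 1)"
      if K: "K \<in> cliques_over S E k {}" for K
    proof -
      have fK: "finite K" using K is_clique_finite[OF _ fin] by (auto simp: cliques_over_def)
      have "{p \<in> ?P. fst p \<in> K \<and> snd p \<in> K} = Sigma K (\<lambda>u. K - {u})"
        using K irrefl by (auto simp: cliques_over_def is_clique_def)
      hence "card {p \<in> ?P. fst p \<in> K \<and> snd p \<in> K} = (\<Sum>u\<in>K. card (K - {u}))"
        using fK by simp
      also have "\<dots> = k * (k - 1)" using K fK by (simp add: cliques_over_def)
      finally show ?thesis by (cases k) (auto simp: algebra_simps)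
    qed
    thus ?thesis by simp
  qed
  also have "\<dots> = (\<Sum>p\<in>?P. real (cliques_through S E k (fst p) (snd p)))"
  proof -
    have "(\<Sum>K\<in>cliques_over S E k {}. card {p \<in> ?P. fst p \<in> K \<and> snd p \<in> K})
        = (\<Sum>p\<in>?P. cliques_through S E k (fst p) (snd p))"
    proof (rule sum_multicount_gen)
      show "\<forall>p\<in>?P. card {K \<in> cliques_over S E k {}. fst p \<in> K \<and> snd p \<in> K}
          = cliques_through S E k (fst p) (snd p)"
        by (auto simp: cliques_through_def cliques_over_def conj_assoc)
    qed (use fin finP in auto)
    thus ?thesis by (simp only: flip: of_nat_sum)
  qed
  also have "\<dots> < (\<Sum>p\<in>?P. ?c)"
    by (rule sum_strict_mono) (use finP ne less in auto)
  also have "\<dots> = real (degree_sum S E) * ?c" using cP by simp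
  finally show False by simp
qed

section \<open>The Moon-Moser inequalities and dense graphs\<close>

text \<open>The squared codegrees regroup into a sum over cliques \<open>A\<close> on
  \<open>k + 1\<close> vertices of the codegrees of all \<open>A - {x}\<close>. There a vertex
  adjacent to all of \<open>A\<close> is counted \<open>k + 1\<close> times; any other vertex is
  counted at most once, since the deleted \<open>x\<close> must be the one it misses.\<close>

lemma moon_moser:
  assumes fin: "finite S"
  shows "(\<Sum>B\<in>cliques_over S E k {}. real (card (common_nbrs S E B)) ^ 2)
    \<le> real (card S) * real (card (cliques_over S E (Suc k) {}))
      + real k * real (k + 2) * real (card (cliques_over S E (k + 2) {}))"
proof -
  have pt: "(\<Sum>x\<in>A. real (card (common_nbrs S E (A - {x}))))
      \<le> real (card S) + real k * real (card (common_nbrs S E A))"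
    if A: "A \<in> cliques_over S E (Suc k) {}" for A
  proof -
    have fA: "finite A" "card A = Suc k"
      using A is_clique_finite[OF _ fin] by (auto simp: cliques_over_def)
    have one: "card {x \<in> A. y \<in> common_nbrs S E (A - {x})} \<le> 1 + (if y \<in> common_nbrs S E A then k else 0)"
      if y: "y \<in> S" for y
    proof (cases "y \<in> common_nbrs S E A")
      case True
      have "card {x \<in> A. y \<in> common_nbrs S E (A - {x})} \<le> card A"
        by (rule card_mono) (use fA in auto)
      then show ?thesis using True fA by simp
    next
      case False
      then obtain b where b: "b \<in> A" "\<not> E b y" using y by (auto simp: common_nbrs_def)
      hence "{x \<in> A. y \<in> common_nbrs S E (A - {x})} \<subseteq> {b}" by (auto simp: common_nbrs_def)
      hence "card {x \<in> A. y \<in> common_nbrs S E (A - {x})} \<le> card {b}" by (intro card_mono) auto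
      then show ?thesis using False by simp
    qed
    have "(\<Sum>x\<in>A. card {y \<in> S. y \<in> common_nbrs S E (A - {x})})
        = (\<Sum>y\<in>S. card {x \<in> A. y \<in> common_nbrs S E (A - {x})})"
      by (rule sum_multicount_gen) (use fin fA in auto)
    also have "(\<Sum>x\<in>A. card {y \<in> S. y \<in> common_nbrs S E (A - {x})})
        = (\<Sum>x\<in>A. card (common_nbrs S E (A - {x})))"
      by (simp add: common_nbrs_def)
    also have "(\<Sum>y\<in>S. card {x \<in> A. y \<in> common_nbrs S E (A - {x})})
        \<le> (\<Sum>y\<in>S. 1 + (if y \<in> common_nbrs S E A then k else 0))"
      by (rule sum_mono) (use one in auto)
    also have "\<dots> = card S + k * card (common_nbrs S E A)"
    proof -
      have "S \<inter> {y. y \<in> common_nbrs S E A} = common_nbrs S E A" by (auto simp: common_nbrs_def)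
      thus ?thesis using fin by (simp only: sum.distrib) (simp add: sum.If_cases)
    qed
    finally show ?thesis by (metis of_nat_add of_nat_le_iff of_nat_mult of_nat_sum)
  qed
  have "(\<Sum>B\<in>cliques_over S E k {}. real (card (common_nbrs S E B)) ^ 2)
     = (\<Sum>A\<in>cliques_over S E (Suc k) {}. \<Sum>x\<in>A. real (card (common_nbrs S E (A - {x}))))"
    using sum_clique_extensions[OF fin, where f = "\<lambda>B. real (card (common_nbrs S E B))" and k = k and ?B0.0 = "{}"]
    by (simp add: power2_eq_square)
  also have "\<dots> \<le> (\<Sum>A\<in>cliques_over S E (Suc k) {}. real (card S) + real k * real (card (common_nbrs S E A)))"
    by (rule sum_mono) (rule pt)
  also have "\<dots> = real (card S) * real (card (cliques_over S E (Suc k) {}))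
      + real k * real (k + 2) * real (card (cliques_over S E (k + 2) {}))"
    using sum_card_common_nbrs[OF fin, of "{}" 0 "Suc k"]
    by (simp add: sum.distrib sum_distrib_left[symmetric])
  finally show ?thesis .
qed

text \<open>The Moon-Moser inequalities propagate the excess density: by induction the average
  codegree of an \<open>s\<close>-clique is at least \<open>N (1 - s/r + s w)\<close>. At
  \<open>s = r\<close> the excess alone remains and still yields cliques on \<open>r + 1\<close>
  vertices, which are then averaged over the edges.\<close>

lemma dense_imp_frequent_edge:
  fixes w :: real
  assumes fin: "finite S" and ne: "S \<noteq> {}" and r: "2 \<le> r" and w: "0 < w"
    and dense: "(1 - 1 / real r + w) * real (card S) ^ 2 \<le> real (degree_sum S E)"
  shows "\<exists>u\<in>S. \<exists>v\<in>S. E u v \<and>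
    w * real r / (real r - 1) * real (card S) ^ (r - 1) / real r ^ (r - 2)
      \<le> real (cliques_through S E (Suc r) u v)"
proof -
  define N where "N = real (card S)"
  define K where "K s = real (card (cliques_over S E s {}))" for s
  define D where "D = real (degree_sum S E)"
  have N: "0 < N" using fin ne by (simp add: N_def card_gt_0_iff)
  have D: "0 < D"
  proof -
    have "0 < (1 - 1 / real r + w) * N ^ 2" using N r w by (simp add: add_nonneg_pos)
    thus ?thesis using dense by (simp add: N_def D_def)
  qed
  have K1: "K 1 = N" unfolding K_def singletons_eq_cliques[OF fin] N_def
    by (subst card_image) auto
  have claim: "0 < K s \<and> K s * (N * (1 - real s / real r + real s * w)) \<le> real (Suc s) * K (Suc s)"
    if "1 \<le> s" "s \<le> r" for s
    using that
  proof (induction s rule: nat_induct_at_least)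
    case base
    show ?case using K1 N dense degree_sum_eq_cliques[OF fin]
      by (simp add: K_def N_def power2_eq_square numeral_2_eq_2 algebra_simps)
  next
    case (Suc s)
    define \<mu> where "\<mu> = N * (1 - real s / real r + real s * w)"
    have IH: "0 < K s" "K s * \<mu> \<le> real (Suc s) * K (Suc s)"
      using Suc unfolding \<mu>_def by auto
    have \<mu>: "0 < \<mu>" unfolding \<mu>_def using N Suc w by (intro mult_pos_pos add_nonneg_pos) auto
    have "0 < real (Suc s) * K (Suc s)" using IH \<mu> by (smt (verit) mult_pos_pos)
    hence pos: "0 < K (Suc s)" by (simp add: zero_less_mult_iff)
    \<comment> \<open>Replacing \<open>x\<^sup>2\<close> by its tangent \<open>2 \<mu> x - \<mu>\<^sup>2\<close> does the work of Cauchy-Schwarz.\<close>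
    have "(\<Sum>B\<in>cliques_over S E s {}. 2 * \<mu> * real (card (common_nbrs S E B)) - \<mu> ^ 2)
        \<le> (\<Sum>B\<in>cliques_over S E s {}. real (card (common_nbrs S E B)) ^ 2)"
    proof (rule sum_mono)
      fix B
      have "0 \<le> (real (card (common_nbrs S E B)) - \<mu>) ^ 2" by simp
      thus "2 * \<mu> * real (card (common_nbrs S E B)) - \<mu> ^ 2 \<le> real (card (common_nbrs S E B)) ^ 2"
        by (simp add: power2_eq_square algebra_simps)
    qed
    also have "\<dots> \<le> N * K (Suc s) + real s * real (s + 2) * K (s + 2)"
      using moon_moser[OF fin, of s] by (simp add: N_def K_def)
    also have "(\<Sum>B\<in>cliques_over S E s {}. 2 * \<mu> * real (card (common_nbrs S E B)) - \<mu> ^ 2)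
        = 2 * \<mu> * (real (Suc s) * K (Suc s)) - K s * \<mu> ^ 2"
      using sum_card_common_nbrs[OF fin, of "{}" 0 s]
      by (simp add: sum_subtractf sum_distrib_left[symmetric] K_def)
    finally have "2 * \<mu> * (real (Suc s) * K (Suc s)) - (K s * \<mu>) * \<mu>
        \<le> N * K (Suc s) + real s * real (s + 2) * K (s + 2)"
      by (simp add: power2_eq_square algebra_simps)
    moreover have "(K s * \<mu>) * \<mu> \<le> (real (Suc s) * K (Suc s)) * \<mu>"
      using IH \<mu> by (intro mult_right_mono) auto
    ultimately have "K (Suc s) * (\<mu> * real (Suc s) - N) \<le> real s * (real (s + 2) * K (s + 2))"
      by (simp add: algebra_simps)
    \<comment> \<open>With this identity the bound reproduces itself for \<open>s + 1\<close>: the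
      extra factor \<open>s\<close> cancels against the one in the Moon-Moser inequality.\<close>
    moreover have "\<mu> * real (Suc s) - N = real s * (N * (1 - real (Suc s) / real r + real (Suc s) * w))"
      unfolding \<mu>_def using r by (simp add: field_simps)
    ultimately have "real s * (K (Suc s) * (N * (1 - real (Suc s) / real r + real (Suc s) * w)))
        \<le> real s * (real (s + 2) * K (s + 2))"
      by (simp only: mult.left_commute mult.assoc)
    hence "K (Suc s) * (N * (1 - real (Suc s) / real r + real (Suc s) * w)) \<le> real (s + 2) * K (s + 2)"
      by (rule mult_left_le_imp_le) (use Suc in auto)
    thus ?case using pos by simp
  qed
  \<comment> \<open>The average of \<open>cliques_through S E s\<close> over ordered adjacent pairs,
    equal to 1 at \<open>s = 2\<close>.\<close>
  define \<tau> where "\<tau> s = real s * (real s - 1) * K s / D" for s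
  \<comment> \<open>The gain is \<open>\<gamma> = w r / (r - 1)\<close>, so that
    \<open>\<gamma> (r - 1) N\<close> is the codegree bound \<open>w r N\<close> at
    \<open>s = r\<close>.\<close>
  have "w * real r / (real r - 1) * N ^ (r - 1) / real r ^ (r - 2) \<le> \<tau> (Suc r)"
  proof (rule iterated_extension_bound[OF r])
    show "0 \<le> N" using N by simp
    show "0 \<le> w * real r / (real r - 1)" using w r by simp
    show "1 \<le> \<tau> 2" using degree_sum_eq_cliques[OF fin] D by (simp add: \<tau>_def D_def K_def)
    have aux: "\<tau> s * (g * N) \<le> \<tau> (Suc s) * (real s - 1)"
      if s: "2 \<le> s" "s \<le> r" and g: "g \<le> 1 - real s / real r + real s * w" for s g
    proof -
      have "K s * (g * N) \<le> K s * (N * (1 - real s / real r + real s * w))"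
        using g N claim[of s] s by (intro mult_left_mono) (auto simp: mult.commute)
      also have "\<dots> \<le> real (Suc s) * K (Suc s)" using claim[of s] s by simp
      finally have "(real s * (real s - 1) / D) * (K s * (g * N))
          \<le> (real s * (real s - 1) / D) * (real (Suc s) * K (Suc s))"
        using s D by (intro mult_left_mono) auto
      thus ?thesis by (simp add: \<tau>_def mult_ac)
    qed
    show "\<tau> s * ((1 - real s / real r) * N) \<le> \<tau> (Suc s) * (real s - 1)" if "2 \<le> s" "s < r" for s
      using aux[of s "1 - real s / real r"] that w by simp
    show "\<tau> r * (w * real r / (real r - 1) * (real r - 1) * N) \<le> \<tau> (Suc r) * (real r - 1)"
      using aux[of r "w * real r"] r by (simp add: mult.commute)
  qed
  moreover have "\<tau> (Suc r) = real (Suc r) * (real (Suc r) - 1)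
      * real (card (cliques_over S E (Suc r) {})) / real (degree_sum S E)"
    by (simp add: \<tau>_def K_def D_def)
  ultimately show ?thesis
    using exists_frequent_edge[OF fin, of "Suc r"] D unfolding N_def D_def by fastforce
qed

subsection \<open>Cliques in graphs of large minimum degree\<close>

text \<open>Average the codegree over the \<open>(r + 1) r\<close> ordered pairs of
  \<open>K\<close>. Counted from the side of \<open>y\<close>, the total is the sum of
  \<open>g y (g y - 1)\<close>; a linear lower bound for this reduces it to the sum of
  \<open>g\<close>, which is the degree sum over \<open>K\<close>.\<close>

lemma clique_has_large_codegree_pair:
  fixes d :: real
  assumes fin: "finite S" and r: "1 \<le> r" and K: "K \<in> cliques_over S E (Suc r) {}"
    and deg: "\<And>v. v \<in> S \<Longrightarrow> d \<le> real (degree_in S E v)"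
  shows "\<exists>u\<in>K. \<exists>v\<in>K. u \<noteq> v \<and>
    2 * (real r - 1) * d / real r - (real r - 1) / (real r + 1) * real (card S)
      \<le> real (card (common_nbrs S E {u, v}))"
proof (rule ccontr)
  let ?c = "2 * (real r - 1) * d / real r - (real r - 1) / (real r + 1) * real (card S)"
  let ?P = "Sigma K (\<lambda>u. K - {u})"
  define g where "g y = card {x \<in> K. E x y}" for y
  assume "\<not> ?thesis"
  hence less: "real (card (common_nbrs S E {u, v})) < ?c" if "u \<in> K" "v \<in> K" "u \<noteq> v" for u v
    using that by force
  have K': "finite K" "card K = Suc r" "K \<subseteq> S"
    using K is_clique_finite[OF _ fin] by (auto simp: cliques_over_def is_clique_def)
  have cP: "card ?P = Suc r * r" using K' by simp
  have ne: "?P \<noteq> {}" using cP r by (metis card.empty mult_is_0 not_one_le_zero old.nat.distinct(1))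
  have gsum: "(\<Sum>x\<in>K. degree_in S E x) = (\<Sum>y\<in>S. g y)"
    unfolding degree_in_def
    by (rule sum_multicount_gen) (use fin K' in \<open>auto simp: g_def\<close>)
  have "(\<Sum>p\<in>?P. card {y \<in> S. E (fst p) y \<and> E (snd p) y}) = (\<Sum>y\<in>S. g y * (g y - 1))"
  proof (rule sum_multicount_gen)
    show "\<forall>y\<in>S. card {p \<in> ?P. E (fst p) y \<and> E (snd p) y} = g y * (g y - 1)"
    proof
      fix y
      have "{p \<in> ?P. E (fst p) y \<and> E (snd p) y} = Sigma {x \<in> K. E x y} (\<lambda>u. {x \<in> K. E x y} - {u})"
        by auto
      hence "card {p \<in> ?P. E (fst p) y \<and> E (snd p) y}
          = (\<Sum>u\<in>{x \<in> K. E x y}. card ({x \<in> K. E x y} - {u}))" using K' by simp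
      also have "\<dots> = (\<Sum>u\<in>{x \<in> K. E x y}. g y - 1)"
        by (rule sum.cong) (use K' in \<open>auto simp: g_def\<close>)
      finally show "card {p \<in> ?P. E (fst p) y \<and> E (snd p) y} = g y * (g y - 1)" by (simp add: g_def)
    qed
  qed (use fin K' in auto)
  hence "(\<Sum>p\<in>?P. real (card (common_nbrs S E {fst p, snd p}))) = (\<Sum>y\<in>S. real (g y * (g y - 1)))"
    by (simp add: common_nbrs_def del: of_nat_mult flip: of_nat_sum)
  moreover have "(\<Sum>y\<in>S. real (g y * (g y - 1)))
      \<ge> (\<Sum>y\<in>S. 2 * (real r - 1) * real (g y) - real r * (real r - 1))"
  proof (rule sum_mono)
    fix y
    \<comment> \<open>The right-hand side is the secant of the convex function \<open>x (x - 1)\<close> through \<open>r - 1\<close> and \<open>r\<close>.\<close>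
    have "0 \<le> (int (g y) - int r) * (int (g y) - int r + 1)"
      by (cases "int r \<le> int (g y)") (auto intro: mult_nonneg_nonneg mult_nonpos_nonpos)
    hence "0 \<le> real_of_int ((int (g y) - int r) * (int (g y) - int r + 1))" by (simp only: of_int_0_le_iff)
    hence "0 \<le> (real (g y) - real r) * (real (g y) - real r + 1)" by simp
    moreover have "real (g y * (g y - 1)) = real (g y) * (real (g y) - 1)"
      by (cases "g y") (auto simp: algebra_simps)
    ultimately show "2 * (real r - 1) * real (g y) - real r * (real r - 1) \<le> real (g y * (g y - 1))"
      by (simp add: algebra_simps)
  qed
  moreover have "(\<Sum>y\<in>S. 2 * (real r - 1) * real (g y) - real r * (real r - 1))
      = 2 * (real r - 1) * (\<Sum>x\<in>K. real (degree_in S E x)) - real (card S) * (real r * (real r - 1))"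
    using gsum by (simp add: sum_subtractf sum_distrib_left[symmetric] flip: of_nat_sum)
  moreover have "2 * (real r - 1) * (\<Sum>x\<in>K. real (degree_in S E x)) \<ge> 2 * (real r - 1) * (real (Suc r) * d)"
    using r sum_mono[of K "\<lambda>_. d" "\<lambda>x. real (degree_in S E x)"] deg K' by (intro mult_left_mono) auto
  moreover have "(\<Sum>p\<in>?P. real (card (common_nbrs S E {fst p, snd p}))) < (\<Sum>p\<in>?P. ?c)"
    by (rule sum_strict_mono) (use K' ne less in auto)
  moreover have "(\<Sum>p\<in>?P. ?c) = real (Suc r) * real r * ?c"
    using cP by (metis of_nat_mult sum_constant)
  moreover have "real (Suc r) * real r * ?c
      = 2 * (real r - 1) * (real (Suc r) * d) - real (card S) * (real r * (real r - 1))"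
  proof -
    have "Q * R * (x / R - y / Q * z) = Q * x - z * (R * y)" if "Q \<noteq> 0" "R \<noteq> 0" for Q R x y z :: real
      using that by (simp add: field_simps)
    from this[of "real r + 1" "real r" "2 * (real r - 1) * d" "real r - 1" "real (card S)"]
    show ?thesis using r by (simp add: algebra_simps)
  qed
  ultimately show False by linarith
qed

text \<open>Greedy extension by minimum degree alone could fail at the last vertex. Starting from an
  edge of \<open>K\<close> with large codegree supplies the missing margin, and each further vertex
  excludes at most \<open>(1/r + 1/r^4) N\<close> common neighbours.\<close>

lemma clique_imp_frequent_edge:
  assumes fin: "finite S" and r: "2 \<le> r" and K: "K \<in> cliques_over S E (Suc r) {}"
    and deg: "\<And>v. v \<in> S \<Longrightarrow> (1 - 1 / real r - 1 / real r ^ 4) * real (card S) \<le> real (degree_in S E v)"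
  shows "\<exists>u\<in>S. \<exists>v\<in>S. E u v \<and> real (card S) ^ (r - 1) / real r ^ (r + 3)
      \<le> real (cliques_through S E (Suc r) u v)"
proof -
  define N where "N = real (card S)"
  define \<rho> where "\<rho> = real r"
  \<comment> \<open>The codegree fraction given by \<open>clique_has_large_codegree_pair\<close> for
    the assumed minimum degree.\<close>
  define q where "q = 2 * (\<rho> - 1) * (1 - 1 / \<rho> - 1 / \<rho> ^ 4) / \<rho> - (\<rho> - 1) / (\<rho> + 1)"
  have \<rho>: "2 \<le> \<rho>" using r by (simp add: \<rho>_def)
  have N: "0 \<le> N" by (simp add: N_def)
  obtain u v where uv: "u \<in> K" "v \<in> K" "u \<noteq> v" "q * N \<le> real (card (common_nbrs S E {u, v}))"
  proof -
    have "2 * (\<rho> - 1) * ((1 - 1 / \<rho> - 1 / \<rho> ^ 4) * N) / \<rho> - (\<rho> - 1) / (\<rho> + 1) * N = q * N"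
      by (simp add: q_def algebra_simps)
    thus ?thesis
      using clique_has_large_codegree_pair[OF fin _ K deg] r that by (fastforce simp: N_def \<rho>_def)
  qed
  have S: "u \<in> S" "v \<in> S" "E u v" using uv K by (auto simp: cliques_over_def is_clique_def)
  have codeg: "(q - (real s - 2) * (1 / \<rho> + 1 / \<rho> ^ 4)) * N \<le> real (card (common_nbrs S E B))"
    if B: "B \<in> cliques_over S E s {u, v}" for B s
  proof -
    have B': "finite B" "card B = s" "{u, v} \<subseteq> B" "B \<subseteq> S"
      using B is_clique_finite[OF _ fin] by (auto simp: cliques_over_def is_clique_def)
    let ?A = "common_nbrs S E {u, v}"
    have "card {z \<in> ?A. \<exists>b\<in>B - {u, v}. \<not> E b z} \<le> (\<Sum>b\<in>B - {u, v}. card {z \<in> S. \<not> E b z})"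
    proof -
      have "card {z \<in> ?A. \<exists>b\<in>B - {u, v}. \<not> E b z} \<le> card (\<Union>b\<in>B - {u, v}. {z \<in> S. \<not> E b z})"
        by (rule card_mono) (use fin B' in \<open>auto simp: common_nbrs_def\<close>)
      also have "\<dots> \<le> (\<Sum>b\<in>B - {u, v}. card {z \<in> S. \<not> E b z})"
        by (rule card_UN_le) (use B' in auto)
      finally show ?thesis .
    qed
    hence "real (card {z \<in> ?A. \<exists>b\<in>B - {u, v}. \<not> E b z}) \<le> (\<Sum>b\<in>B - {u, v}. real (card {z \<in> S. \<not> E b z}))"
      by (simp flip: of_nat_sum)
    also have "\<dots> \<le> (\<Sum>b\<in>B - {u, v}. (1 / \<rho> + 1 / \<rho> ^ 4) * N)"
    proof (rule sum_mono)
      fix b assume b: "b \<in> B - {u, v}"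
      show "real (card {z \<in> S. \<not> E b z}) \<le> (1 / \<rho> + 1 / \<rho> ^ 4) * N"
        using deg[of b] b B' unfolding card_non_nbrs[OF fin] N_def \<rho>_def by (auto simp: algebra_simps)
    qed
    also have "\<dots> = (real s - 2) * ((1 / \<rho> + 1 / \<rho> ^ 4) * N)"
    proof -
      have "2 \<le> s" using B' uv card_mono[of B "{u, v}"] by auto
      hence "real (card (B - {u, v})) = real s - 2" using B' uv by (simp add: card_Diff_subset of_nat_diff)
      thus ?thesis by simp
    qed
    finally have 1: "real (card {z \<in> ?A. \<exists>b\<in>B - {u, v}. \<not> E b z}) \<le> (real s - 2) * ((1 / \<rho> + 1 / \<rho> ^ 4) * N)" .
    have "card ?A = card {z \<in> ?A. \<exists>b\<in>B - {u, v}. \<not> E b z} + card (common_nbrs S E B)"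
      by (subst card_Un_disjoint[symmetric])
        (use fin B' in \<open>auto simp: common_nbrs_def intro!: arg_cong[where f = card]\<close>)
    thus ?thesis using 1 uv(4) by (simp add: algebra_simps)
  qed
  define \<tau> where "\<tau> s = real (card (cliques_over S E s {u, v}))" for s
  have step: "\<tau> s * (g * N) \<le> \<tau> (Suc s) * (real s - 1)"
    if g: "g \<le> q - (real s - 2) * (1 / \<rho> + 1 / \<rho> ^ 4)" for s g
  proof -
    have "\<tau> s * (g * N) = (\<Sum>B\<in>cliques_over S E s {u, v}. g * N)" by (simp add: \<tau>_def)
    also have "\<dots> \<le> (\<Sum>B\<in>cliques_over S E s {u, v}. real (card (common_nbrs S E B)))"
      using codeg[of _ s] mult_right_mono[OF g N] by (intro sum_mono) force
    also have "\<dots> = \<tau> (Suc s) * (real s - 1)"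
      using sum_card_common_nbrs[OF fin, of "{u, v}" 2 s] uv by (simp add: \<tau>_def)
    finally show ?thesis .
  qed
  \<comment> \<open>The margin left at \<open>s = r\<close>, which allows
    \<open>\<gamma> = 1 / \<rho>^5\<close> below. Multiplied by
    \<open>(\<rho> + 1) \<rho>^5\<close>, the difference of the two sides is
    \<open>\<rho> (\<rho> - 1)^2 + \<rho> + 3\<close>.\<close>
  have num: "(\<rho> - 1) / \<rho> ^ 5 \<le> q - (\<rho> - 2) * (1 / \<rho> + 1 / \<rho> ^ 4)"
  proof -
    have e1: "1 - 1 / \<rho> - 1 / \<rho> ^ 4 = (\<rho> ^ 4 - \<rho> ^ 3 - 1) / \<rho> ^ 4"
      and e2: "1 / \<rho> + 1 / \<rho> ^ 4 = (\<rho> ^ 4 + \<rho>) / \<rho> ^ 5"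
      using \<rho> by (simp_all add: field_simps eval_nat_numeral)
    have e3: "q = 2 * (\<rho> - 1) * (\<rho> ^ 4 - \<rho> ^ 3 - 1) / \<rho> ^ 5 - (\<rho> - 1) / (\<rho> + 1)"
      unfolding q_def e1 using \<rho> by (simp add: eval_nat_numeral)
    define P where "P = \<rho> ^ 5"
    have P: "0 < P" using \<rho> by (simp add: P_def)
    have clear: "Q * P * (a / P - b / Q - c * (d / P) - b / P) = Q * a - b * P - Q * (c * d) - Q * b"
      if "Q \<noteq> 0" for Q a b c d
      using that P by (simp add: field_simps)
    have "(\<rho> + 1) * P * (q - (\<rho> - 2) * (1 / \<rho> + 1 / \<rho> ^ 4) - (\<rho> - 1) / P)
        = (\<rho> + 1) * (2 * (\<rho> - 1) * (\<rho> ^ 4 - \<rho> ^ 3 - 1)) - (\<rho> - 1) * P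
          - (\<rho> + 1) * ((\<rho> - 2) * (\<rho> ^ 4 + \<rho>)) - (\<rho> + 1) * (\<rho> - 1)"
      unfolding e3 e2 P_def[symmetric] by (rule clear) (use \<rho> in simp)
    also have "\<dots> = \<rho> * (\<rho> - 1) ^ 2 + \<rho> + 3"
      unfolding P_def by (simp add: algebra_simps eval_nat_numeral)
    also have "\<dots> \<ge> 0" using \<rho> by simp
    finally have "(\<rho> + 1) * P * 0
        \<le> (\<rho> + 1) * P * (q - (\<rho> - 2) * (1 / \<rho> + 1 / \<rho> ^ 4) - (\<rho> - 1) / P)" by simp
    hence "0 \<le> q - (\<rho> - 2) * (1 / \<rho> + 1 / \<rho> ^ 4) - (\<rho> - 1) / P"
      by (rule mult_left_le_imp_le) (use \<rho> P in simp)
    thus ?thesis by (simp add: P_def)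
  qed
  have "1 / \<rho> ^ 5 * N ^ (r - 1) / real r ^ (r - 2) \<le> \<tau> (Suc r)"
  proof (rule iterated_extension_bound[OF r N])
    show "0 \<le> 1 / \<rho> ^ 5" using \<rho> by simp
    have "{u, v} \<in> cliques_over S E 2 {u, v}"
      using S uv sym by (auto simp: cliques_over_def is_clique_def)
    hence "card (cliques_over S E 2 {u, v}) > 0" using fin by (auto simp: card_gt_0_iff)
    thus "1 \<le> \<tau> 2" by (simp add: \<tau>_def)
    show "\<tau> s * ((1 - real s / real r) * N) \<le> \<tau> (Suc s) * (real s - 1)" if s: "2 \<le> s" "s < r" for s
    proof (rule step)
      \<comment> \<open>Compared with \<open>s = r\<close>, a clique on \<open>s\<close> vertices
        has suffered \<open>\<rho> - s\<close> fewer losses, each worth at least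
        \<open>1 / \<rho>\<close>.\<close>
      have split: "(a - 2) * e = (b - 2) * e - e * (b - a)" for a b e :: real
        by (simp add: algebra_simps)
      have "(1 / \<rho> + 1 / \<rho> ^ 4) * (\<rho> - real s) \<ge> 1 / \<rho> * (\<rho> - real s)"
        using s \<rho> by (intro mult_right_mono) (auto simp: \<rho>_def)
      moreover have "1 / \<rho> * (\<rho> - real s) = 1 - real s / real r"
        using \<rho> by (simp add: field_simps \<rho>_def)
      moreover have "0 \<le> (\<rho> - 1) / \<rho> ^ 5" using \<rho> by simp
      ultimately show "1 - real s / real r \<le> q - (real s - 2) * (1 / \<rho> + 1 / \<rho> ^ 4)"
        using num split[where a = "real s" and b = \<rho> and e = "1 / \<rho> + 1 / \<rho> ^ 4"] by linarith
    qed
    show "\<tau> r * (1 / \<rho> ^ 5 * (real r - 1) * N) \<le> \<tau> (Suc r) * (real r - 1)"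
      using step[of "1 / \<rho> ^ 5 * (real r - 1)" r] num by (simp add: \<rho>_def)
  qed
  moreover have "1 / \<rho> ^ 5 * N ^ (r - 1) / real r ^ (r - 2) = real (card S) ^ (r - 1) / real r ^ (r + 3)"
  proof -
    have "r + 3 = 5 + (r - 2)" using r by simp
    hence "real r ^ (r + 3) = \<rho> ^ 5 * real r ^ (r - 2)" by (simp only: power_add \<rho>_def)
    thus ?thesis by (simp add: N_def)
  qed
  ultimately show ?thesis using S unfolding \<tau>_def cliques_through_eq by auto
qed


section \<open>Clique-free graphs of large minimum degree are \<open>r\<close>-partite\<close>

text \<open>Greedy choice: \<open>m k\<close> bounds what a vertex chosen from \<open>B k\<close>
  excludes in any other class, so a class larger than the sum of the other bounds has a vertex left
  even when it comes last.\<close>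

lemma clique_transversal:
  fixes m :: "'b \<Rightarrow> real"
  assumes "finite J" and "\<And>j. j \<in> J \<Longrightarrow> finite (B j)" and "\<And>j. j \<in> J \<Longrightarrow> 0 \<le> m j"
    and "\<And>j. j \<in> J \<Longrightarrow> (\<Sum>k\<in>J - {j}. m k) < real (card (B j))"
    and "\<And>j k y. j \<in> J \<Longrightarrow> k \<in> J \<Longrightarrow> j \<noteq> k \<Longrightarrow> y \<in> B k \<Longrightarrow> real (card {z \<in> B j. \<not> E y z}) \<le> m k"
  shows "\<exists>y. (\<forall>j\<in>J. y j \<in> B j) \<and> (\<forall>j\<in>J. \<forall>k\<in>J. j \<noteq> k \<longrightarrow> E (y j) (y k))"
  using assms
proof (induction J rule: finite_induct)
  case empty
  then show ?case by simp
next
  case (insert j J)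
  have "\<exists>y. (\<forall>j\<in>J. y j \<in> B j) \<and> (\<forall>j\<in>J. \<forall>k\<in>J. j \<noteq> k \<longrightarrow> E (y j) (y k))"
  proof (rule insert.IH)
    fix i assume i: "i \<in> J"
    have "(\<Sum>k\<in>J - {i}. m k) \<le> (\<Sum>k\<in>insert j J - {i}. m k)"
      by (rule sum_mono2) (use insert in auto)
    also have "\<dots> < real (card (B i))" using insert.prems(3) i by simp
    finally show "(\<Sum>k\<in>J - {i}. m k) < real (card (B i))" .
  qed (use insert.prems in auto)
  then obtain y where y: "\<forall>j\<in>J. y j \<in> B j" "\<forall>j\<in>J. \<forall>k\<in>J. j \<noteq> k \<longrightarrow> E (y j) (y k)" by blast
  have "real (card (\<Union>k\<in>J. {z \<in> B j. \<not> E (y k) z})) \<le> (\<Sum>k\<in>J. real (card {z \<in> B j. \<not> E (y k) z}))"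
    using card_UN_le[OF insert.hyps(1)] by (simp flip: of_nat_sum)
  also have "\<dots> \<le> (\<Sum>k\<in>J. m k)"
  proof (rule sum_mono)
    fix k assume "k \<in> J"
    thus "real (card {z \<in> B j. \<not> E (y k) z}) \<le> m k"
      using insert.prems(4)[of j k "y k"] y insert.hyps by auto
  qed
  also have "\<dots> < real (card (B j))" using insert.prems(3)[of j] insert.hyps by simp
  finally have "card (\<Union>k\<in>J. {z \<in> B j. \<not> E (y k) z}) < card (B j)" by simp
  hence "\<not> B j \<subseteq> (\<Union>k\<in>J. {z \<in> B j. \<not> E (y k) z})"
    using card_mono[of "\<Union>k\<in>J. {z \<in> B j. \<not> E (y k) z}" "B j"] insert by auto
  then obtain z where z: "z \<in> B j" "\<forall>k\<in>J. E (y k) z" by auto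
  show ?case
    by (rule exI[of _ "y(j := z)"]) (use y z insert.hyps in \<open>auto intro: sym\<close>)
qed

lemma clique_insert:
  assumes "finite S" "B \<in> cliques_over S E k {}" "x \<in> common_nbrs S E B"
  shows "insert x B \<in> cliques_over S E (Suc k) {}"
proof -
  have "x \<notin> B" using assms irrefl by (auto simp: common_nbrs_def)
  thus ?thesis using assms is_clique_finite[OF _ assms(1), of E B]
    by (auto simp: cliques_over_def is_clique_def common_nbrs_def intro: sym)
qed

text \<open>Greedy growth: fewer than \<open>r\<close> vertices cannot exclude all of
  \<open>S\<close>, because \<open>(r - 1) (1/r + 1/r^4) < 1\<close>.\<close>

lemma exists_clique:
  assumes fin: "finite S" and ne: "S \<noteq> {}" and r: "2 \<le> r" and k: "k \<le> r"
    and deg: "\<And>v. v \<in> S \<Longrightarrow> (1 - 1 / real r - 1 / real r ^ 4) * real (card S) \<le> real (degree_in S E v)"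
  shows "cliques_over S E k {} \<noteq> {}"
  using k
proof (induction k)
  case 0
  have "{} \<in> cliques_over S E 0 {}" by (simp add: cliques_over_def is_clique_def)
  then show ?case by blast
next
  case (Suc k)
  then obtain B where B: "B \<in> cliques_over S E k {}" by auto
  have B': "finite B" "card B = k" "B \<subseteq> S"
    using B is_clique_finite[OF _ fin] by (auto simp: cliques_over_def is_clique_def)
  let ?N = "real (card S)" let ?\<eta> = "1 / real r + 1 / real r ^ 4"
  have N: "0 < ?N" using fin ne by (simp add: card_gt_0_iff)
  have "(\<Sum>b\<in>B. ?N - real (degree_in S E b)) \<le> (\<Sum>b\<in>B. ?\<eta> * ?N)"
    by (rule sum_mono) (use deg B' in \<open>force simp: algebra_simps\<close>)
  hence 1: "?N - real k * (?\<eta> * ?N) \<le> real (card (common_nbrs S E B))"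
    using card_common_nbrs_ge[OF fin B'(1)] B' by simp
  have "real k * ?\<eta> \<le> (real r - 1) * ?\<eta>" using Suc.prems by (intro mult_right_mono) auto
  also have "\<dots> < 1"
  proof -
    have "real r ^ 3 \<ge> real r * 1" using r power_increasing[of 1 3 "real r"] by simp
    hence "real r - 1 < real r ^ 3" by linarith
    hence "(real r - 1) * (1 / real r ^ 4) < real r ^ 3 * (1 / real r ^ 4)"
      using r by (intro mult_strict_right_mono) auto
    also have "\<dots> = 1 / real r" using r by (simp add: eval_nat_numeral)
    finally show ?thesis using r by (simp add: algebra_simps diff_divide_distrib)
  qed
  finally have "real k * ?\<eta> * ?N < 1 * ?N" using N by (intro mult_strict_right_mono)
  hence "0 < card (common_nbrs S E B)" using 1 by simp
  then obtain x where "x \<in> common_nbrs S E B" by (auto simp: card_gt_0_iff)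
  then show ?case using clique_insert[OF fin B] by blast
qed

text \<open>Fix a clique \<open>R\<close> on \<open>r\<close> vertices. The vertices adjacent to all
  of \<open>R\<close> except \<open>v\<close> form almost a whole colour class \<open>A v\<close>,
  and each vertex is coloured by some \<open>v\<close> such that it has no neighbour in
  \<open>A v\<close>. A vertex without a colour, or an edge inside a colour class, would extend
  through a transversal to a clique on \<open>r + 1\<close> vertices.\<close>

lemma colourable_if_clique_free:
  assumes fin: "finite S" and r: "2 \<le> r"
    and deg: "\<And>v. v \<in> S \<Longrightarrow> (1 - 1 / real r - 1 / real r ^ 4) * real (card S) \<le> real (degree_in S E v)"
    and free: "cliques_over S E (Suc r) {} = {}"
  shows "\<exists>f. proper_colouring S E r f"
proof (cases "S = {}")
  case True
  then show ?thesis by (simp add: proper_colouring_def)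
next
  case ne: False
  define N where "N = real (card S)"
  define \<beta> where "\<beta> = 1 / real r ^ 4"
  define \<eta> where "\<eta> = 1 / real r + \<beta>"
  have N: "0 < N" using fin ne by (simp add: N_def card_gt_0_iff)
  have \<beta>: "0 < \<beta>" using r by (simp add: \<beta>_def)
  have non: "real (card {z \<in> S. \<not> E x z}) \<le> \<eta> * N" if "x \<in> S" for x
    using deg[OF that] card_non_nbrs[OF fin, of x] by (simp add: N_def \<eta>_def \<beta>_def algebra_simps)
  obtain R where R0: "R \<in> cliques_over S E r {}"
    using exists_clique[OF fin ne r order_refl deg] by blast
  hence R: "is_clique S E R" "finite R" "card R = r" "R \<subseteq> S"
    using is_clique_finite[OF _ fin] by (auto simp: cliques_over_def is_clique_def)
  have adjR: "E b c" if "b \<in> R" "c \<in> R" "b \<noteq> c" for b c using R that by (auto simp: is_clique_def)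
  have noR: "\<exists>b\<in>R. \<not> E b x" if "x \<in> S" for x
    using clique_insert[OF fin R0, of x] that free by (auto simp: common_nbrs_def)
  \<comment> \<open>The sets \<open>A v\<close> are disjoint, independent and cover almost all of \<open>S\<close>. A vertex with no neighbour
    in \<open>A v\<close> misses at most \<open>m v\<close> vertices outside it, so transversal cliques can be built greedily.\<close>
  define A where "A v = common_nbrs S E (R - {v})" for v
  define m where "m v = \<eta> * N - real (card (A v))" for v
  have mA: "real (card (A v)) = \<eta> * N - m v" for v by (simp add: m_def)
  have finA: "finite (A v)" for v using fin by (simp add: A_def)
  have AS: "A v \<subseteq> S" for v by (auto simp: A_def common_nbrs_def)
  have vA: "v \<in> A v" if "v \<in> R" for v
    using that R adjR by (auto simp: A_def common_nbrs_def)
  have disj: "A v \<inter> A w = {}" if "v \<noteq> w" for v w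
  proof (rule ccontr)
    assume "A v \<inter> A w \<noteq> {}"
    then obtain x where "x \<in> A v" "x \<in> A w" by auto
    hence "x \<in> S" "\<forall>b\<in>R. E b x" using that by (auto simp: A_def common_nbrs_def)
    thus False using noR by blast
  qed
  have indep: "\<not> E x y" if "v \<in> R" "x \<in> A v" "y \<in> A v" for v x y
  proof
    assume xy: "E x y"
    have Rv: "R - {v} \<in> cliques_over S E (r - 1) {}"
      using R that by (auto simp: cliques_over_def is_clique_def)
    have "insert x (R - {v}) \<in> cliques_over S E (Suc (r - 1)) {}"
      by (rule clique_insert[OF fin Rv]) (use that in \<open>simp add: A_def\<close>)
    moreover have "y \<in> common_nbrs S E (insert x (R - {v}))"
      using that xy by (auto simp: A_def common_nbrs_def)
    ultimately have "insert y (insert x (R - {v})) \<in> cliques_over S E (Suc (Suc (r - 1))) {}"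
      by (rule clique_insert[OF fin])
    thus False using free r by simp
  qed
  have miss: "real (card {z \<in> A j. \<not> E x z}) \<le> m v"
    if "x \<in> S" "j \<noteq> v" "\<forall>z\<in>A v. \<not> E x z" for x v j
  proof -
    have "card {z \<in> A j. \<not> E x z} + card (A v) = card ({z \<in> A j. \<not> E x z} \<union> A v)"
      using disj[OF that(2)] finA by (subst card_Un_disjoint) auto
    also have "\<dots> \<le> card {z \<in> S. \<not> E x z}"
      by (rule card_mono) (use that AS fin in auto)
    finally show ?thesis using non[OF that(1)] by (simp add: m_def)
  qed
  have missA: "real (card {z \<in> A j. \<not> E y z}) \<le> m v" if "v \<in> R" "j \<noteq> v" "y \<in> A v" for v j y
    using miss[of y j v] that AS indep by blast
  have m0: "0 \<le> m v" if "v \<in> R" for v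
  proof -
    have "card (A v) \<le> card {z \<in> S. \<not> E v z}"
      by (rule card_mono) (use fin AS vA indep that in auto)
    thus ?thesis using non[of v] R that unfolding m_def by force
  qed
  \<comment> \<open>Union bound over the \<open>r - 1\<close> vertices of \<open>R - {v}\<close>,
    combined with \<open>r \<eta> = 1 + r \<beta>\<close>.\<close>
  have m1: "m v \<le> real r * \<beta> * N" if "v \<in> R" for v
  proof -
    have "(\<Sum>b\<in>R - {v}. N - real (degree_in S E b)) \<le> (\<Sum>b\<in>R - {v}. \<eta> * N)"
      by (rule sum_mono) (use non card_non_nbrs[OF fin] R in \<open>auto simp: N_def\<close>)
    also have "\<dots> = (real r - 1) * (\<eta> * N)" using R r that by (simp add: of_nat_diff)
    finally have "N - (real r - 1) * (\<eta> * N) \<le> real (card (A v))"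
      using card_common_nbrs_ge[OF fin, of "R - {v}"] R by (simp add: N_def A_def)
    moreover have "real r * \<eta> = 1 + real r * \<beta>" using r by (simp add: \<eta>_def algebra_simps)
    hence "real r * (\<eta> * N) = N + real r * \<beta> * N" by (metis distrib_right mult.assoc mult_1)
    ultimately show ?thesis by (simp add: m_def algebra_simps)
  qed
  \<comment> \<open>Count the edges between \<open>R\<close> and \<open>S\<close>: every vertex
    misses a member of \<open>R\<close>, and one outside \<open>U\<close> misses two. For
    \<open>r > 2\<close> this beats adding up the \<open>r\<close> single bounds
    \<open>m1\<close>.\<close>
  have msum: "(\<Sum>v\<in>R. m v) \<le> 2 * real r * \<beta> * N"
  proof -
    define U where "U = (\<Union>v\<in>R. A v)"
    have "(\<Sum>b\<in>R. degree_in S E b) = (\<Sum>x\<in>S. card {b \<in> R. E b x})"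
      unfolding degree_in_def by (rule sum_multicount_gen) (use fin R in auto)
    hence "(\<Sum>b\<in>R. real (degree_in S E b)) = (\<Sum>x\<in>S. real (card {b \<in> R. E b x}))"
      by (metis of_nat_sum)
    also have "\<dots> \<le> (\<Sum>x\<in>S. (real r - 2) + (if x \<in> U then 1 else 0))"
    proof (rule sum_mono)
      fix x assume x: "x \<in> S"
      have eq: "card {b \<in> R. E b x} + card {b \<in> R. \<not> E b x} = r"
        unfolding R(3)[symmetric]
        by (subst card_Un_disjoint[symmetric]) (use R in \<open>auto intro: arg_cong[where f = card]\<close>)
      obtain b where b: "b \<in> R" "\<not> E b x" using noR x by blast
      have c1: "1 \<le> card {b \<in> R. \<not> E b x}" using b R by (auto simp: Suc_le_eq card_gt_0_iff)
      have c2: "2 \<le> card {b \<in> R. \<not> E b x}" if "x \<notin> U"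
      proof -
        have "x \<notin> A b" using that b by (auto simp: U_def)
        then obtain c where c: "c \<in> R" "c \<noteq> b" "\<not> E c x" using x by (auto simp: A_def common_nbrs_def)
        have "card {b, c} \<le> card {b \<in> R. \<not> E b x}" by (rule card_mono) (use b c R in auto)
        thus ?thesis using c by simp
      qed
      show "real (card {b \<in> R. E b x}) \<le> (real r - 2) + (if x \<in> U then 1 else 0)"
        using eq c1 c2 by (cases "x \<in> U") auto
    qed
    also have "\<dots> = (real r - 2) * N + real (card U)"
    proof -
      have "S \<inter> {x. x \<in> U} = U" using AS by (auto simp: U_def)
      thus ?thesis using fin by (simp only: sum.distrib sum.If_cases) (simp add: N_def)
    qed
    also have "real (card U) = (\<Sum>v\<in>R. real (card (A v)))"
      unfolding U_def by (subst card_UN_disjoint) (use R finA disj in auto)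
    also have "\<dots> = real r * (\<eta> * N) - (\<Sum>v\<in>R. m v)"
      using R by (simp add: m_def sum_subtractf)
    finally have 1: "(\<Sum>b\<in>R. real (degree_in S E b)) \<le> (real r - 2) * N + (real r * (\<eta> * N) - (\<Sum>v\<in>R. m v))" .
    have "(\<Sum>b\<in>R. N - \<eta> * N) \<le> (\<Sum>b\<in>R. real (degree_in S E b))"
      by (rule sum_mono) (use non card_non_nbrs[OF fin] R in \<open>force simp: N_def\<close>)
    hence "real r * (N - \<eta> * N) \<le> (\<Sum>b\<in>R. real (degree_in S E b))" using R by simp
    moreover have "real r * \<eta> = 1 + real r * \<beta>" using r by (simp add: \<eta>_def algebra_simps)
    hence "real r * (\<eta> * N) = N + real r * \<beta> * N" by (metis distrib_right mult.assoc mult_1)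
    ultimately show ?thesis using 1 by (simp add: algebra_simps)
  qed
  \<comment> \<open>A transversal of the \<open>r - 1\<close> classes other than \<open>A v\<close>,
    taken inside the common neighbourhood of \<open>p\<close> and \<open>q\<close>, would complete
    the edge \<open>pq\<close> to a clique on \<open>r + 1\<close> vertices.\<close>
  have complete: False
    if v: "v \<in> R" and pq: "p \<in> S" "q \<in> S" "E p q"
      and big: "\<And>j. j \<in> R - {v} \<Longrightarrow>
        (\<Sum>k\<in>R - {v} - {j}. m k) < real (card {z \<in> A j. E p z \<and> E q z})" for v p q
  proof -
    define B where "B j = {z \<in> A j. E p z \<and> E q z}" for j
    have "\<exists>y. (\<forall>j\<in>R - {v}. y j \<in> B j) \<and> (\<forall>j\<in>R - {v}. \<forall>k\<in>R - {v}. j \<noteq> k \<longrightarrow> E (y j) (y k))"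
    proof (rule clique_transversal[where m = m])
      fix j k y assume jk: "j \<in> R - {v}" "k \<in> R - {v}" "j \<noteq> k" "y \<in> B k"
      have "card {z \<in> B j. \<not> E y z} \<le> card {z \<in> A j. \<not> E y z}"
        by (rule card_mono) (use finA in \<open>auto simp: B_def\<close>)
      thus "real (card {z \<in> B j. \<not> E y z}) \<le> m k"
        using missA[of k j y] jk by (auto simp: B_def)
    qed (use R finA m0 big in \<open>auto simp: B_def\<close>)
    then obtain y where y: "\<forall>j\<in>R - {v}. y j \<in> B j"
      "\<forall>j\<in>R - {v}. \<forall>k\<in>R - {v}. j \<noteq> k \<longrightarrow> E (y j) (y k)" by blast
    have inj: "inj_on y (R - {v})" using y(2) irrefl by (metis inj_onI)
    have "y j \<in> S" if "j \<in> R - {v}" for j using that y(1) AS by (auto simp: B_def)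
    moreover have "E (y j) (y k)" if "j \<in> R - {v}" "k \<in> R - {v}" "y j \<noteq> y k" for j k
      using that y(2) by metis
    ultimately have "is_clique S E (y ` (R - {v}))" unfolding is_clique_def by blast
    hence cl: "y ` (R - {v}) \<in> cliques_over S E (r - 1) {}"
      using R v card_image[OF inj] by (simp add: cliques_over_def)
    have "p \<in> common_nbrs S E (y ` (R - {v}))"
      using pq y(1) by (auto simp: common_nbrs_def B_def intro: sym)
    hence "insert p (y ` (R - {v})) \<in> cliques_over S E (Suc (r - 1)) {}"
      by (rule clique_insert[OF fin cl])
    moreover have "q \<in> common_nbrs S E (insert p (y ` (R - {v})))"
      using pq y(1) by (auto simp: common_nbrs_def B_def intro: sym)
    ultimately have "insert q (insert p (y ` (R - {v}))) \<in> cliques_over S E (Suc (Suc (r - 1))) {}"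
      by (rule clique_insert[OF fin])
    thus False using free r by simp
  qed
  have split: "(\<Sum>k\<in>R - {j}. m k) = m v + (\<Sum>k\<in>R - {v} - {j}. m k)" if "v \<in> R" "j \<noteq> v" for v j
    using that R by (subst sum.remove[of "R - {j}" v]) (auto simp: Diff_insert2[symmetric] insert_commute)
  have colour: "\<exists>v\<in>R. \<forall>z\<in>A v. \<not> E x z" if x: "x \<in> S" for x
  proof (rule ccontr)
    assume "\<not> ?thesis"
    hence nb: "\<exists>z\<in>A v. E x z" if "v \<in> R" for v using that by blast
    define g where "g v = card {z \<in> A v. E x z}" for v
    have "R \<noteq> {}" using R r by auto
    then obtain i where i: "i \<in> R" "\<forall>j\<in>R. g i \<le> g j"
      using R(2) by (metis arg_min_least arg_min_if_finite(1))
    obtain y where y: "y \<in> A i" "E x y" using nb i by blast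
    \<comment> \<open>By minimality of \<open>g i\<close>, \<open>x\<close> has many neighbours in every other class.\<close>
    show False
    proof (rule complete[OF i(1) x _ y(2)])
      show "y \<in> S" using y AS by blast
      fix j assume j: "j \<in> R - {i}"
      \<comment> \<open>The misses of \<open>x\<close> in two disjoint classes total at most
        \<open>\<eta> N\<close>. Since \<open>g i \<le> g j\<close>, at least half of
        \<open>\<eta> N - m i - m j\<close> falls to \<open>g j\<close>.\<close>
      have "real (g i) + real (g j) \<ge> real (card (A i)) + real (card (A j)) - \<eta> * N"
      proof -
        have cA: "card (A v) = g v + card {z \<in> A v. \<not> E x z}" for v
          unfolding g_def
          by (subst card_Un_disjoint[symmetric]) (use finA in \<open>auto intro: arg_cong[where f = card]\<close>)
        have "card {z \<in> A i. \<not> E x z} + card {z \<in> A j. \<not> E x z} \<le> card {z \<in> S. \<not> E x z}"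
          by (subst card_Un_disjoint[symmetric])
            (use finA disj[of i j] j AS fin in \<open>auto intro!: card_mono\<close>)
        hence "real (card {z \<in> A i. \<not> E x z}) + real (card {z \<in> A j. \<not> E x z}) \<le> \<eta> * N"
          using non[OF x] by linarith
        thus ?thesis by (simp add: cA[of i] cA[of j])
      qed
      moreover have "real (g i) \<le> real (g j)" using i j by auto
      moreover have "m i + m j \<le> (\<Sum>v\<in>R. m v)"
        using sum_mono2[of R "{i, j}" m] R i j m0 by auto
      ultimately have "\<eta> * N - 2 * real r * \<beta> * N \<le> 2 * real (g j)"
        using msum mA[of i] mA[of j] by linarith
      hence gj: "(\<eta> * N - 2 * real r * \<beta> * N) / 2 \<le> real (g j)" by simp
      have Sj: "(\<Sum>k\<in>R - {j}. m k) < (\<eta> * N - 2 * real r * \<beta> * N) / 2"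
      \<comment> \<open>The general estimate needs \<open>6 r < r^3 + 1\<close>, which fails at
        \<open>r = 2\<close>; there the sum has a single term and \<open>m1\<close>
        suffices.\<close>
      proof (cases "r = 2")
        case True
        have "card (R - {j}) = 1" using j R True by simp
        then obtain k where k: "R - {j} = {k}" by (auto simp: card_1_singleton_iff)
        hence "(\<Sum>k\<in>R - {j}. m k) = m k" by simp
        also have "\<dots> \<le> 2 * \<beta> * N" using m1[of k] k True by auto
        also have "\<dots> < (\<eta> * N - 2 * real r * \<beta> * N) / 2"
          using True N by (simp add: \<eta>_def \<beta>_def)
        finally show ?thesis .
      next
        case False
        hence r3: "3 \<le> real r" using r by simp
        have "(\<Sum>k\<in>R - {j}. m k) \<le> (\<Sum>k\<in>R. m k)"
          by (rule sum_mono2) (use R m0 in auto)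
        also have "\<dots> \<le> 2 * real r * \<beta> * N" by (rule msum)
        also have "\<dots> < (\<eta> * N - 2 * real r * \<beta> * N) / 2"
        proof -
          have "3 * 3 * real r \<le> real r * real r * real r"
            using r3 by (intro mult_right_mono mult_mono) auto
          hence "6 * real r < real r ^ 3 + 1" using r3 unfolding power3_eq_cube by linarith
          hence "6 * real r * \<beta> < (real r ^ 3 + 1) * \<beta>" using \<beta> by (rule mult_strict_right_mono)
          also have "(real r ^ 3 + 1) * \<beta> = \<eta>" using r3 by (simp add: \<eta>_def \<beta>_def field_simps eval_nat_numeral)
          finally have "6 * real r * \<beta> * N < \<eta> * N" using N by (rule mult_strict_right_mono)
          thus ?thesis by (simp add: mult_ac)
        qed
        finally show ?thesis .
      qed
      \<comment> \<open>As a vertex of \<open>A i\<close>, \<open>y\<close> excludes at most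
        \<open>m i\<close> vertices of \<open>A j\<close>, which is exactly the term of
        \<open>i\<close> in the sum over \<open>R - {j}\<close>.\<close>
      have "g j \<le> card {z \<in> A j. E x z \<and> E y z} + card {z \<in> A j. \<not> E y z}"
      proof -
        have "g j \<le> card ({z \<in> A j. E x z \<and> E y z} \<union> {z \<in> A j. \<not> E y z})"
          unfolding g_def by (rule card_mono) (use finA in auto)
        also have "\<dots> \<le> card {z \<in> A j. E x z \<and> E y z} + card {z \<in> A j. \<not> E y z}" by (rule card_Un_le)
        finally show ?thesis .
      qed
      hence "real (g j) \<le> real (card {z \<in> A j. E x z \<and> E y z}) + m i"
        using missA[of i j y] i j y by fastforce
      thus "(\<Sum>k\<in>R - {i} - {j}. m k) < real (card {z \<in> A j. E x z \<and> E y z})"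
        using gj Sj split[of i j] i j by auto
    qed
  qed
  then obtain c where c: "\<forall>x\<in>S. c x \<in> R \<and> (\<forall>z\<in>A (c x). \<not> E x z)" by metis
  have proper: "c x \<noteq> c y" if xy: "x \<in> S" "y \<in> S" "E x y" for x y
  proof
    assume eq: "c x = c y"
    define v where "v = c x"
    have v: "v \<in> R" "\<forall>z\<in>A v. \<not> E x z" "\<forall>z\<in>A v. \<not> E y z" using c xy eq by (auto simp: v_def)
    show False
    proof (rule complete[OF v(1) xy])
      fix j assume j: "j \<in> R - {v}"
      have "card (A j) \<le> card {z \<in> A j. E x z \<and> E y z} + (card {z \<in> A j. \<not> E x z} + card {z \<in> A j. \<not> E y z})"
      proof -
        have "card (A j) \<le> card ({z \<in> A j. E x z \<and> E y z} \<union> ({z \<in> A j. \<not> E x z} \<union> {z \<in> A j. \<not> E y z}))"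
          by (rule card_mono) (use finA in auto)
        also have "\<dots> \<le> card {z \<in> A j. E x z \<and> E y z} + card ({z \<in> A j. \<not> E x z} \<union> {z \<in> A j. \<not> E y z})"
          by (rule card_Un_le)
        finally show ?thesis using card_Un_le[of "{z \<in> A j. \<not> E x z}" "{z \<in> A j. \<not> E y z}"] by linarith
      qed
      hence 1: "real (card (A j)) \<le> real (card {z \<in> A j. E x z \<and> E y z}) + 2 * m v"
        using miss[of x j v] miss[of y j v] xy v j by fastforce
      have 2: "(\<Sum>k\<in>R. m k) = m j + (m v + (\<Sum>k\<in>R - {v} - {j}. m k))"
        using split[of v j] v j R by (subst sum.remove[of R j]) auto
      \<comment> \<open>After cancellation the goal is that the sum of all \<open>m k\<close> plus
        one more \<open>m v\<close> lies below \<open>\<eta> N\<close>; \<open>msum\<close> and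
        \<open>m1\<close> bound it by \<open>3 r \<beta> N\<close>.\<close>
      have "3 * real r * \<beta> * N < \<eta> * N"
      proof -
        have "2 * 2 * real r \<le> real r * real r * real r"
          using r by (intro mult_right_mono mult_mono) auto
        hence "3 * real r < real r ^ 3 + 1" unfolding power3_eq_cube by linarith
        hence "3 * real r * \<beta> < (real r ^ 3 + 1) * \<beta>" using \<beta> by (rule mult_strict_right_mono)
        also have "(real r ^ 3 + 1) * \<beta> = \<eta>" using r by (simp add: \<eta>_def \<beta>_def field_simps eval_nat_numeral)
        finally show ?thesis using N by (rule mult_strict_right_mono)
      qed
      hence "2 * real r * \<beta> * N + real r * \<beta> * N < \<eta> * N" by (simp add: algebra_simps)
      thus "(\<Sum>k\<in>R - {v} - {j}. m k) < real (card {z \<in> A j. E x z \<and> E y z})"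
        using 1 2 msum m1[OF v(1)] mA[of j] by linarith
    qed
  qed
  obtain h where h: "bij_betw h R {0..<r}" using ex_bij_betw_finite_nat[OF R(2)] R(3) by auto
  show ?thesis
  proof (rule exI[of _ "h \<circ> c"], unfold proper_colouring_def, intro conjI ballI impI)
    fix x assume "x \<in> S"
    thus "(h \<circ> c) x < r" using c bij_betwE[OF h] by auto
  next
    fix x y assume xy: "x \<in> S" "y \<in> S" "E x y"
    thus "(h \<circ> c) x \<noteq> (h \<circ> c) y"
      using c proper[OF xy] bij_betw_imp_inj_on[OF h] by (auto dest: inj_onD)
  qed
qed


subsection \<open>Graphs above the Turan density\<close>

lemma degree_le_of_colouring:
  assumes fin: "finite S" and col: "proper_colouring S E r f" and v: "v \<in> S"
  shows "real (degree_in S E v) \<le> real (card S) - real (card {x \<in> S. f x = f v})"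
proof -
  have "card {x \<in> S. f x = f v} \<le> card {z \<in> S. \<not> E v z}"
    by (rule card_mono) (use fin col v in \<open>force simp: proper_colouring_def\<close>)+
  thus ?thesis using card_non_nbrs[OF fin, of v] by linarith
qed

lemma sum_colour_classes:
  fixes g :: "nat \<Rightarrow> real"
  assumes fin: "finite S" and col: "proper_colouring S E r f"
  shows "(\<Sum>v\<in>S. g (f v)) = (\<Sum>i<r. real (card {x \<in> S. f x = i}) * g i)"
proof -
  have "(\<Sum>v\<in>S. g (f v)) = (\<Sum>i<r. \<Sum>v\<in>{x \<in> S. f x = i}. g (f v))"
    by (rule sum.group[symmetric]) (use fin col in \<open>auto simp: proper_colouring_def\<close>)
  thus ?thesis by simp
qed

text \<open>The sum on the left is the degree sum of the complete multipartite graph on the colour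
  classes. Besides Turan's bound, the exact variance term serves the integrality argument for very
  small \<open>\<alpha>\<close>.\<close>

lemma degree_sum_of_colouring:
  assumes fin: "finite S" and col: "proper_colouring S E r f" and r: "0 < r"
  shows "(\<Sum>v\<in>S. real (card S) - real (card {x \<in> S. f x = f v}))
    = (1 - 1 / real r) * real (card S) ^ 2 - (\<Sum>i<r. (real (card {x \<in> S. f x = i}) - real (card S) / real r) ^ 2)"
proof -
  define a where "a i = real (card {x \<in> S. f x = i})" for i
  define N where "N = real (card S)"
  have N: "(\<Sum>i<r. a i) = N"
    using sum_colour_classes[OF fin col, of "\<lambda>_. 1"] by (simp add: a_def N_def)
  have "(\<Sum>v\<in>S. N - a (f v)) = N ^ 2 - (\<Sum>i<r. a i ^ 2)"
    using sum_colour_classes[OF fin col, of a]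
    by (simp add: sum_subtractf a_def N_def power2_eq_square)
  moreover have "(\<Sum>i<r. (a i - N / real r) ^ 2) = (\<Sum>i<r. a i ^ 2) - 2 * (N / real r) * (\<Sum>i<r. a i) + real r * (N / real r) ^ 2"
    by (simp add: power2_diff sum.distrib sum_subtractf sum_distrib_left sum_divide_distrib mult_ac)
  moreover have "2 * (N / real r) * N - real r * (N / real r) ^ 2 = N ^ 2 / real r"
    using r by (simp add: power2_eq_square)
  ultimately have "(\<Sum>v\<in>S. N - a (f v)) = (1 - 1 / real r) * N ^ 2 - (\<Sum>i<r. (a i - N / real r) ^ 2)"
    unfolding N by (simp add: left_diff_distrib)
  thus ?thesis by (simp only: a_def N_def)
qed

lemma degree_sum_le_of_colourable:
  assumes fin: "finite S" and col: "proper_colouring S E r f" and r: "0 < r"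
  shows "real (degree_sum S E) \<le> (1 - 1 / real r) * real (card S) ^ 2"
proof -
  have "real (degree_sum S E) \<le> (\<Sum>v\<in>S. real (card S) - real (card {x \<in> S. f x = f v}))"
    unfolding degree_sum_def of_nat_sum by (rule sum_mono) (rule degree_le_of_colouring[OF fin col])
  also have "\<dots> \<le> (1 - 1 / real r) * real (card S) ^ 2"
    unfolding degree_sum_of_colouring[OF assms] by (simp add: sum_nonneg)
  finally show ?thesis .
qed

text \<open>Deleting \<open>M\<close> removes the degrees of its vertices and lowers those of the
  others by at most the same total. Edges inside \<open>M\<close> are overcharged, hence an
  inequality.\<close>

lemma degree_sum_diff:
  assumes fin: "finite S" and M: "M \<subseteq> S"
  shows "real (degree_sum S E) - 2 * (\<Sum>v\<in>M. real (degree_in S E v)) \<le> real (degree_sum (S - M) E)"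
proof -
  have finM: "finite M" using fin M by (rule rev_finite_subset)
  have d: "degree_in S E v = degree_in (S - M) E v + card {u \<in> M. E v u}" for v
    unfolding degree_in_def
    by (subst card_Un_disjoint[symmetric]) (use fin finM M in \<open>auto intro!: arg_cong[where f = card]\<close>)
  have "degree_sum S E = (\<Sum>v\<in>S - M. degree_in S E v) + (\<Sum>v\<in>M. degree_in S E v)"
    unfolding degree_sum_def by (rule sum.subset_diff[OF M fin])
  also have "(\<Sum>v\<in>S - M. degree_in S E v) = degree_sum (S - M) E + (\<Sum>v\<in>S - M. card {u \<in> M. E v u})"
    by (simp add: d sum.distrib degree_sum_def)
  also have "(\<Sum>v\<in>S - M. card {u \<in> M. E v u}) = (\<Sum>u\<in>M. card {v \<in> S - M. E v u})"
    by (rule sum_multicount_gen) (use fin finM in auto)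
  also have "\<dots> \<le> (\<Sum>u\<in>M. degree_in S E u)"
    by (rule sum_mono) (use fin sym in \<open>auto simp: degree_in_def intro!: card_mono\<close>)
  finally have "degree_sum S E \<le> degree_sum (S - M) E + 2 * (\<Sum>v\<in>M. degree_in S E v)" by simp
  hence "real (degree_sum S E) \<le> real (degree_sum (S - M) E + 2 * (\<Sum>v\<in>M. degree_in S E v))"
    by (simp only: of_nat_le_iff)
  thus ?thesis by simp
qed

text \<open>The exponent \<open>r + 5\<close> collects \<open>r - 2\<close> from the iterated
  extension, 1 from the shrunken order, 2 from the fraction \<open>k / h \<ge> 1/r^2\<close> of
  peeled vertices and 4 from the degree threshold \<open>1/r^4\<close>.\<close>

lemma super_turan_imp_frequent_edge:
  assumes fin: "finite S" and r: "2 \<le> r" and large: "2 * real r ^ 4 \<le> real (card S)"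
    and dense: "(1 - 1 / real r) * real (card S) ^ 2 < real (degree_sum S E)"
  shows "\<exists>u\<in>S. \<exists>v\<in>S. E u v \<and> real (card S) ^ (r - 1) / real r ^ (r + 5)
      \<le> real (cliques_through S E (Suc r) u v)"
proof (rule ccontr)
  define h where "h = real (card S)"
  define \<beta> where "\<beta> = 1 / real r ^ 4"
  define \<kappa> where "\<kappa> = 1 - 1 / real r"
  assume "\<not> ?thesis"
  hence less: "real (cliques_through S E (Suc r) u v) < h ^ (r - 1) / real r ^ (r + 5)"
    if "u \<in> S" "v \<in> S" "E u v" for u v using that by (force simp: h_def)
  have \<beta>: "0 < \<beta>" and \<kappa>: "1 / 2 \<le> \<kappa>" "\<kappa> < 1" using r by (auto simp: \<beta>_def \<kappa>_def field_simps)
  have r4: "real r * 8 \<le> real r ^ 4"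
    using power_mono[of 2 "real r" 3] r by (simp add: power_Suc2[of "real r" 3, simplified] mult.commute)
  have h: "0 < h" "4 * real r \<le> h" "2 \<le> \<beta> * h"
  proof -
    show "4 * real r \<le> h" using large r4 by (simp add: h_def)
    thus "0 < h" using r by linarith
    have "\<beta> * (2 * real r ^ 4) \<le> \<beta> * h" using large \<beta> by (simp add: h_def)
    thus "2 \<le> \<beta> * h" using r by (simp add: \<beta>_def)
  qed
  \<comment> \<open>At most a \<open>1/r\<close> part of the vertices is peeled off, so the power
    \<open>r - 1\<close> of the order drops by at most a factor \<open>r\<close>.\<close>
  have bern: "1 / real r \<le> \<kappa> ^ (r - 1)"
  proof -
    have "1 + real (r - 1) * (- (1 / real r)) \<le> (1 + - (1 / real r)) ^ (r - 1)"
      by (rule Bernoulli_inequality) (use r in simp)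
    moreover have "1 + real (r - 1) * (- (1 / real r)) = 1 / real r"
      using r by (simp add: of_nat_diff field_simps)
    ultimately show ?thesis by (simp add: \<kappa>_def)
  qed
  have pow: "h ^ (r - 1) / real r \<le> real (card S') ^ (r - 1)" if "\<kappa> * h \<le> real (card S')" for S' :: "'a set"
  proof -
    have "h ^ (r - 1) * (1 / real r) \<le> h ^ (r - 1) * \<kappa> ^ (r - 1)"
      using bern h by (intro mult_left_mono) auto
    also have "\<dots> = (\<kappa> * h) ^ (r - 1)" by (simp add: power_mult_distrib)
    also have "\<dots> \<le> real (card S') ^ (r - 1)" using that \<kappa> h by (intro power_mono) auto
    finally show ?thesis by simp
  qed
  \<comment> \<open>Here \<open>c\<close> is \<open>1/r^5\<close> when the peeling stops early and
    \<open>k / h * \<beta>\<close> when it runs to the end; both are at least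
    \<open>1/r^6\<close>.\<close>
  have no: False
    if "S' \<subseteq> S" "u \<in> S'" "v \<in> S'" "E u v" "\<kappa> * h \<le> real (card S')" "1 / real r ^ 6 \<le> c"
      and le: "c * real (card S') ^ (r - 1) / real r ^ (r - 2) \<le> real (cliques_through S' E (Suc r) u v)"
    for S' u v c
  proof -
    have "1 / real r ^ 6 * (h ^ (r - 1) / real r) \<le> c * real (card S') ^ (r - 1)"
      by (rule mult_mono) (use pow that h in \<open>auto intro: order_trans[of _ "1 / real r ^ 6"]\<close>)
    hence "1 / real r ^ 6 * (h ^ (r - 1) / real r) / real r ^ (r - 2)
        \<le> c * real (card S') ^ (r - 1) / real r ^ (r - 2)"
      by (rule divide_right_mono) simp
    moreover have "real r ^ (r + 5) = real r ^ 6 * real r * real r ^ (r - 2)"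
    proof -
      have "r + 5 = 6 + 1 + (r - 2)" using r by simp
      thus ?thesis by (metis power_add power_one_right)
    qed
    ultimately have "h ^ (r - 1) / real r ^ (r + 5) \<le> real (cliques_through S' E (Suc r) u v)"
      using le by simp
    also have "\<dots> \<le> real (cliques_through S E (Suc r) u v)"
      using cliques_through_mono[OF that(1) fin] by simp
    also have "\<dots> < h ^ (r - 1) / real r ^ (r + 5)" using less that by blast
    finally show False by simp
  qed
  have low: "\<exists>v\<in>S'. real (degree_in S' E v) < (1 - 1 / real r - 1 / real r ^ 4) * real (card S')"
    if S': "S' \<subseteq> S" "\<kappa> * h \<le> real (card S')" "\<kappa> * real (card S') ^ 2 < real (degree_sum S' E)" for S'
  proof (rule ccontr)
    assume "\<not> ?thesis"
    hence deg: "(1 - 1 / real r - 1 / real r ^ 4) * real (card S') \<le> real (degree_in S' E v)" if "v \<in> S'" for v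
      using that by force
    have fin': "finite S'" using S' fin finite_subset by blast
    show False
    proof (cases "cliques_over S' E (Suc r) {} = {}")
      case True
      then obtain f where "proper_colouring S' E r f" using colourable_if_clique_free[OF fin' r deg] by blast
      thus False using degree_sum_le_of_colourable[OF fin'] r S'(3) by (force simp: \<kappa>_def)
    next
      case False
      then obtain K where "K \<in> cliques_over S' E (Suc r) {}" by blast
      from clique_imp_frequent_edge[OF fin' r this deg] obtain u v where
        uv: "u \<in> S'" "v \<in> S'" "E u v"
        "real (card S') ^ (r - 1) / real r ^ (r + 3) \<le> real (cliques_through S' E (Suc r) u v)" by blast
      show False
      proof (rule no[OF S'(1) uv(1-3) S'(2)])
        show "1 / real r ^ 6 \<le> 1 / real r ^ 5"
          using r power_increasing[of 5 6 "real r"] by (intro divide_left_mono) auto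
        have "r + 3 = 5 + (r - 2)" using r by simp
        hence "real r ^ (r + 3) = real r ^ 5 * real r ^ (r - 2)" by (metis power_add)
        thus "1 / real r ^ 5 * real (card S') ^ (r - 1) / real r ^ (r - 2)
            \<le> real (cliques_through S' E (Suc r) u v)" using uv(4) by simp
      qed
    qed
  qed
  have peel: "\<exists>S'\<subseteq>S. real (card S') = h - real k \<and>
      \<kappa> * real (card S') ^ 2 + real k * (\<beta> * \<kappa> * h) < real (degree_sum S' E)"
    if "real k \<le> h / real r" for k
    using that
  proof (induction k)
    case 0
    then show ?case using dense by (auto simp: h_def \<kappa>_def intro!: exI[of _ S])
  next
    case (Suc k)
    then obtain S' where S': "S' \<subseteq> S" "real (card S') = h - real k"
      "\<kappa> * real (card S') ^ 2 + real k * (\<beta> * \<kappa> * h) < real (degree_sum S' E)" by auto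
    have fin': "finite S'" using S' fin finite_subset by blast
    have big: "\<kappa> * h \<le> real (card S')" using Suc.prems S'(2) by (simp add: \<kappa>_def algebra_simps)
    have "0 \<le> real k * (\<beta> * \<kappa> * h)" using \<beta> \<kappa> h by simp
    hence "\<kappa> * real (card S') ^ 2 < real (degree_sum S' E)" using S'(3) by linarith
    then obtain v where v: "v \<in> S'" "real (degree_in S' E v) < (\<kappa> - \<beta>) * real (card S')"
      using low[OF S'(1) big] by (auto simp: \<kappa>_def \<beta>_def)
    define i where "i = real (card S')"
    have c: "real (card (S' - {v})) = i - 1"
    proof -
      have "0 < card S'" using v fin' by (auto simp: card_gt_0_iff)
      thus ?thesis using v fin' by (simp add: i_def of_nat_diff)
    qed
    \<comment> \<open>The excess over the Turan bound grows by more than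
      \<open>2 \<beta> i - \<kappa>\<close>, where \<open>\<kappa>\<close> comes from squaring
      \<open>i - 1\<close>. One \<open>\<beta> i\<close> covers the claimed growth, the other covers
      \<open>\<kappa>\<close> because \<open>large\<close> makes \<open>\<beta> h\<close> at least
      2.\<close>
    have "\<beta> * (\<kappa> * h) \<le> \<beta> * i" using big \<beta> by (simp add: i_def)
    moreover have "1 \<le> \<beta> * (\<kappa> * h)"
      using mult_mono[of "1 / 2" \<kappa> 2 "\<beta> * h"] \<kappa> h by (simp add: mult_ac)
    ultimately have "\<beta> * \<kappa> * h \<le> 2 * \<beta> * i - \<kappa>" using \<kappa> by (simp add: mult_ac)
    moreover have "real (degree_sum S' E) - 2 * real (degree_in S' E v) \<le> real (degree_sum (S' - {v}) E)"
      using degree_sum_diff[OF fin', of "{v}"] v by simp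
    ultimately have "\<kappa> * (i - 1) ^ 2 + real (Suc k) * (\<beta> * \<kappa> * h) < real (degree_sum (S' - {v}) E)"
      using S'(3) v(2) unfolding i_def[symmetric] by (simp add: power2_eq_square algebra_simps)
    then show ?case using S' c by (intro exI[of _ "S' - {v}"]) (auto simp: i_def)
  qed
  define k where "k = card S div r"
  have k: "real k \<le> h / real r" "h / real r - 1 \<le> real k"
  proof -
    show "real k \<le> h / real r" unfolding k_def h_def by (rule of_nat_div_le_of_nat)
    have "card S \<le> r * k + r" unfolding k_def using r
      by (metis add_le_cancel_left div_mult_mod_eq less_imp_le mod_less_divisor mult.commute not_numeral_le_zero not_gr_zero)
    hence "h \<le> real r * real k + real r" unfolding h_def by (metis of_nat_add of_nat_le_iff of_nat_mult)
    thus "h / real r - 1 \<le> real k" using r by (simp add: field_simps)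
  qed
  obtain S' where S': "S' \<subseteq> S" "real (card S') = h - real k"
    "\<kappa> * real (card S') ^ 2 + real k * (\<beta> * \<kappa> * h) < real (degree_sum S' E)"
    using peel[OF k(1)] by blast
  have fin': "finite S'" using S' fin finite_subset by blast
  have big: "\<kappa> * h \<le> real (card S')" using k S'(2) by (simp add: \<kappa>_def algebra_simps)
  have ne: "S' \<noteq> {}" using big \<kappa> h by (auto simp: mult_le_0_iff)
  have kh: "1 / real r ^ 2 \<le> real k / h"
  proof -
    have "h / real r ^ 2 \<le> h / (2 * real r)"
      using r h by (intro divide_left_mono) (auto simp: power2_eq_square)
    also have "\<dots> \<le> h / real r - 1" using h r by (simp add: field_simps)
    also note k(2)
    finally show ?thesis using h by (simp add: field_simps)
  qed
  hence kpos: "0 < real k / h" using r by (smt (verit) divide_pos_pos of_nat_0_less_iff zero_less_power not_gr_zero not_numeral_le_zero)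
  \<comment> \<open>The accumulated excess \<open>k \<beta> \<kappa> h\<close> divided by
    \<open>h^2\<close>; its factor \<open>\<kappa>\<close> cancels against
    \<open>r / (r - 1)\<close> in the clique bound.\<close>
  define w where "w = real k / h * \<beta> * \<kappa>"
  have w: "0 < w" using kpos \<beta> \<kappa> unfolding w_def by (intro mult_pos_pos) auto
  have "(1 - 1 / real r + w) * real (card S') ^ 2 \<le> real (degree_sum S' E)"
  proof -
    have "w * real (card S') ^ 2 \<le> w * h ^ 2"
      using w S'(2) by (intro mult_left_mono power_mono) auto
    also have "\<dots> = real k * (\<beta> * \<kappa> * h)" using h by (simp add: w_def power2_eq_square)
    finally show ?thesis using S'(3) by (simp add: \<kappa>_def distrib_right)
  qed
  from dense_imp_frequent_edge[OF fin' ne r w this] obtain u v where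
    uv: "u \<in> S'" "v \<in> S'" "E u v"
    "w * real r / (real r - 1) * real (card S') ^ (r - 1) / real r ^ (r - 2)
      \<le> real (cliques_through S' E (Suc r) u v)" by blast
  have "w * real r / (real r - 1) = real k / h * \<beta>"
  proof -
    have "\<kappa> * real r = real r - 1" using r by (simp add: \<kappa>_def left_diff_distrib)
    hence "w * real r = real k / h * \<beta> * (real r - 1)" by (simp only: w_def mult.assoc)
    thus ?thesis using r by simp
  qed
  moreover have "1 / real r ^ 6 \<le> real k / h * \<beta>"
    using mult_right_mono[OF kh, of \<beta>] \<beta> by (simp add: \<beta>_def flip: power_add)
  ultimately show False using no[OF S'(1) uv(1-3) big _ uv(4)] by simp
qed

end


section \<open>Frequent edges or a large \<open>r\<close>-partite subgraph near the Turan
  density\<close>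

lemma js_ge:
  assumes "finite V" "u \<in> V" "v \<in> V" "E u v"
  shows "cliques_through V E (r + 1) u v \<le> js V E r"
proof -
  have "finite {cliques_through V E (r + 1) u v | u v. u \<in> V \<and> v \<in> V \<and> E u v}"
    by (rule finite_subset[of _ "(\<lambda>(u, v). cliques_through V E (r + 1) u v) ` (V \<times> V)"])
      (use assms in auto)
  thus ?thesis unfolding js_def by (intro Max_ge) (use assms in auto)
qed

lemma order_loss_bound:
  fixes h n :: real
  assumes r: "2 \<le> r" and n: "0 < n" and h: "(1 - 1 / (3 * real r ^ 4)) * n \<le> h"
  shows "(1 - 1 / real r ^ 3) * n ^ (r - 1) < h ^ (r - 1)"
proof -
  define x where "x = 1 / (3 * real r ^ 4)"
  have r4: "1 \<le> real r ^ 4" using r by (simp add: one_le_power)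
  have x: "0 \<le> x" "x \<le> 1" using r4 by (auto simp: x_def divide_le_eq)
  have "real (r - 1) * x < 1 / real r ^ 3"
  proof -
    have "real (r - 1) * x = (real r - 1) * x" using r by (simp add: of_nat_diff)
    also have "\<dots> < (3 * real r) * x" using r by (intro mult_strict_right_mono) (auto simp: x_def)
    also have "\<dots> = 1 / real r ^ 3" using r by (simp add: x_def eval_nat_numeral)
    finally show ?thesis .
  qed
  hence "1 - 1 / real r ^ 3 < 1 + real (r - 1) * (- x)" by simp
  also have "\<dots> \<le> (1 + - x) ^ (r - 1)" by (rule Bernoulli_inequality) (use x in simp)
  finally have "(1 - 1 / real r ^ 3) * n ^ (r - 1) < (1 - x) ^ (r - 1) * n ^ (r - 1)"
    using n by (intro mult_strict_right_mono) auto
  also have "\<dots> = ((1 - x) * n) ^ (r - 1)" by (simp add: power_mult_distrib)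
  also have "\<dots> \<le> h ^ (r - 1)" using h x n by (intro power_mono) (auto simp: x_def)
  finally show ?thesis .
qed

theorem theorem8:
  fixes V :: "'a set" and E :: "'a \<Rightarrow> 'a \<Rightarrow> bool" and r n :: nat and \<alpha> :: real
  assumes "simple_graph V E"
    and "card V = n"
    and "r \<ge> 2"
    and "n > r ^ 8"
    and "0 < \<alpha>" and "\<alpha> < 1 / (36 * real r ^ 8)"
    and "real (num_edges V E) > ((real r - 1) / (2 * real r) - \<alpha>) * real n ^ 2"
  shows "real (js V E r) > (1 - 1 / real r ^ 3) * real n ^ (r - 1) / real r ^ (r + 5)
     \<or> (\<exists>S. S \<subseteq> V \<and> S \<noteq> {} \<and> chromatic_number S E \<le> r
            \<and> real (card S) \<ge> (1 - 2 * sqrt \<alpha>) * real n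
            \<and> real (min_degree S E) > (1 - 1 / real r - 6 * sqrt \<alpha>) * real n)"
  (is "?J \<or> ?P")
proof -
  interpret ugraph E using assms(1) by unfold_locales (auto simp: simple_graph_def)
  have fin: "finite V" using assms(1) by (simp add: simple_graph_def)
  note r = \<open>r \<ge> 2\<close>
  define s where "s = sqrt \<alpha>"
  define t where "t = s * real n"
  define \<kappa> where "\<kappa> = 1 - 1 / real r"
  define N where "N = real n"
  have s: "0 < s" "s ^ 2 = \<alpha>" using assms(5) by (auto simp: s_def)
  \<comment> \<open>The root of the bound on \<open>\<alpha>\<close>: a degree loss of
    \<open>6 s\<close> stays within the tolerance \<open>1/r^4\<close> of the clique and colouring
    lemmas.\<close>
  have s6: "6 * s < 1 / real r ^ 4"
  proof -
    have "s < 1 / (6 * real r ^ 4)" unfolding s_def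
    proof (rule real_less_lsqrt)
      show "\<alpha> < (1 / (6 * real r ^ 4))\<^sup>2" using assms(6) by (simp add: power_divide power_mult_distrib)
    qed (use assms(5) r in auto)
    thus ?thesis using r by (simp add: field_simps)
  qed
  have \<kappa>: "1 / 2 \<le> \<kappa>" "\<kappa> < 1" using r by (auto simp: \<kappa>_def field_simps)
  have r4: "16 \<le> real r ^ 4" using power_mono[of 2 "real r" 4] r by simp
  have n8: "real r ^ 8 < N" using assms(4) unfolding N_def by (metis of_nat_less_iff of_nat_power)
  have r8: "real r ^ 8 = real r ^ 4 * real r ^ 4" by (simp flip: power_add)
  have n4: "16 * real r ^ 4 < N"
    using mult_right_mono[OF r4, of "real r ^ 4"] n8 unfolding r8 by simp
  have N: "0 < N" using n4 r4 by linarith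
  have t: "0 < t" "t ^ 2 = \<alpha> * N ^ 2" using s N by (auto simp: t_def N_def power_mult_distrib)
  have cV: "real (card V) = N" using assms(2) by (simp add: N_def)
  have D: "\<kappa> * N ^ 2 - 2 * t ^ 2 < real (degree_sum V E)"
  proof -
    have "\<kappa> * N ^ 2 - 2 * t ^ 2 = 2 * (((real r - 1) / (2 * real r) - \<alpha>) * N ^ 2)"
      unfolding t(2) using r by (simp add: \<kappa>_def field_simps)
    thus ?thesis using assms(7) degree_sum_eq_edges[OF fin] by (simp add: N_def)
  qed
  have small: "1 / real r ^ 4 \<le> 1 / 16" using r4 r by (intro divide_left_mono) auto
  have J: ?J if "S \<subseteq> V" "u \<in> S" "v \<in> S" "E u v" "(1 - 1 / (3 * real r ^ 4)) * N \<le> real (card S)"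
    "real (card S) ^ (r - 1) / real r ^ (r + 5) \<le> real (cliques_through S E (Suc r) u v)" for S u v
  proof -
    have "(1 - 1 / real r ^ 3) * N ^ (r - 1) / real r ^ (r + 5) < real (card S) ^ (r - 1) / real r ^ (r + 5)"
      using order_loss_bound[OF r N that(5)] r by (intro divide_strict_right_mono) auto
    also note that(6)
    also have "real (cliques_through S E (Suc r) u v) \<le> real (cliques_through V E (r + 1) u v)"
      using cliques_through_mono[OF that(1) fin] by simp
    also have "\<dots> \<le> real (js V E r)" using js_ge[of V u v E r] fin that by auto
    finally show ?thesis by (simp add: N_def)
  qed
  have J_dense: ?J
    if S: "S \<subseteq> V" "(1 - 1 / (3 * real r ^ 4)) * N \<le> real (card S)"
      "\<kappa> * real (card S) ^ 2 < real (degree_sum S E)" for S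
  proof -
    have "1 / (3 * real r ^ 4) \<le> 1 / 2" using r4 r by (intro divide_left_mono) auto
    hence "1 / 2 * N \<le> (1 - 1 / (3 * real r ^ 4)) * N" using N by (intro mult_right_mono) auto
    hence "2 * real r ^ 4 \<le> real (card S)" using S(2) n4 r4 by linarith
    from super_turan_imp_frequent_edge[OF finite_subset[OF S(1) fin] r this] S(3)
    show ?thesis using J[OF S(1) _ _ _ S(2)] by (auto simp: \<kappa>_def)
  qed
  have J_or_colouring: "?J \<or> (\<exists>f. proper_colouring S E r f)"
    if S: "S \<subseteq> V" "(1 - 1 / (3 * real r ^ 4)) * N \<le> real (card S)"
      and deg: "\<And>v. v \<in> S \<Longrightarrow> (1 - 1 / real r - 1 / real r ^ 4) * real (card S) \<le> real (degree_in S E v)" for S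
  proof (cases "cliques_over S E (Suc r) {} = {}")
    case True
    then show ?thesis using colourable_if_clique_free[OF finite_subset[OF S(1) fin] r deg] by blast
  next
    case False
    then obtain K where "K \<in> cliques_over S E (Suc r) {}" by blast
    from clique_imp_frequent_edge[OF finite_subset[OF S(1) fin] r this deg] obtain u v where
      uv: "u \<in> S" "v \<in> S" "E u v"
      "real (card S) ^ (r - 1) / real r ^ (r + 3) \<le> real (cliques_through S E (Suc r) u v)" by blast
    have "real (card S) ^ (r - 1) / real r ^ (r + 5) \<le> real (card S) ^ (r - 1) / real r ^ (r + 3)"
      using r by (intro divide_left_mono power_increasing) auto
    then show ?thesis using J[OF S(1) uv(1-3) S(2)] uv(4) by linarith
  qed
  have P: ?P
    if S: "S \<subseteq> V" "(1 - 2 * s) * N \<le> real (card S)" "proper_colouring S E r f"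
      and deg: "\<And>v. v \<in> S \<Longrightarrow> (\<kappa> - 6 * s) * N < real (degree_in S E v)" for S f
  proof -
    have finS: "finite S" using S(1) fin by (rule finite_subset)
    \<comment> \<open>Nonemptiness makes the \<open>Min\<close> in \<open>min_degree\<close> an
      attained value.\<close>
    have "0 < (1 - 2 * s) * N" using N s6 small by (intro mult_pos_pos) auto
    hence ne: "S \<noteq> {}" using S(2) by auto
    have "chromatic_number S E \<le> r" unfolding chromatic_number_def by (rule Least_le) (use S(3) in blast)
    moreover have "min_degree S E \<in> degree_in S E ` S"
      unfolding min_degree_def by (rule Min_in) (use finS ne in auto)
    hence "(\<kappa> - 6 * s) * N < real (min_degree S E)" using deg by auto
    ultimately show ?thesis using S(1,2) ne by (auto simp: N_def s_def \<kappa>_def)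
  qed
  have loss: "(1 - 1 / (3 * real r ^ 4)) * N \<le> (1 - 2 * s) * N"
    using s6 N by (intro mult_right_mono) auto
  \<comment> \<open>The coefficient 4 serves both cases: deleting at most \<open>2 t\<close>
    vertices lowers the degree bound only to \<open>\<kappa> - 6 s\<close>, while deleting vertices
    of degree at most \<open>\<kappa> N - 4 t\<close> makes up for the deficit \<open>2 t^2\<close>
    in the degree sum.\<close>
  define M where "M = {v \<in> V. real (degree_in V E v) \<le> (\<kappa> - 4 * s) * N}"
  have M: "M \<subseteq> V" "finite M" using fin by (auto simp: M_def)
  \<comment> \<open>For \<open>t < 1/2\<close> no positive integer is at most \<open>2 t\<close>, so
    no admissible number of vertices could be deleted; that case is treated apart.\<close>
  consider "real (card M) \<le> 2 * t" | "2 * t < real (card M)" "1 / 2 \<le> t" | "t < 1 / 2"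
    by linarith
  then show ?thesis
  proof cases
    case 1
    have cS: "real (card (V - M)) = N - real (card M)"
      using M fin card_mono[OF fin M(1)] cV by (simp add: card_Diff_subset of_nat_diff)
    have deg: "(\<kappa> - 6 * s) * N < real (degree_in (V - M) E v)" if "v \<in> V - M" for v
    proof -
      have "degree_in V E v \<le> card ({u \<in> V - M. E v u} \<union> M)"
        unfolding degree_in_def by (rule card_mono) (use fin M in auto)
      also have "\<dots> \<le> degree_in (V - M) E v + card M" unfolding degree_in_def by (rule card_Un_le)
      finally have "real (degree_in V E v) \<le> real (degree_in (V - M) E v) + real (card M)"
        by (metis of_nat_add of_nat_le_iff)
      moreover have "(\<kappa> - 4 * s) * N < real (degree_in V E v)" using that by (auto simp: M_def)
      ultimately show ?thesis using 1 by (simp add: t_def N_def algebra_simps)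
    qed
    have order: "(1 - 2 * s) * N \<le> real (card (V - M))"
      using cS 1 by (simp add: t_def N_def algebra_simps)
    have deg': "(1 - 1 / real r - 1 / real r ^ 4) * real (card (V - M)) \<le> real (degree_in (V - M) E v)"
      if "v \<in> V - M" for v
    proof -
      have "(1 - 1 / real r - 1 / real r ^ 4) * real (card (V - M)) \<le> (\<kappa> - 6 * s) * N"
      proof (rule mult_mono)
        show "1 - 1 / real r - 1 / real r ^ 4 \<le> \<kappa> - 6 * s" using s6 by (simp add: \<kappa>_def)
        show "0 \<le> \<kappa> - 6 * s" using s6 small \<kappa> by linarith
      qed (use cS in auto)
      thus ?thesis using deg[OF that] by linarith
    qed
    show ?thesis
      using J_or_colouring[OF Diff_subset order_trans[OF loss order] deg'] P[OF Diff_subset order _ deg]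
      by blast
  next
    case 2
    \<comment> \<open>Since \<open>t \<ge> 1/2\<close>, rounding up gives an integer between
      \<open>t\<close> and \<open>2 t\<close>.\<close>
    define m where "m = nat \<lceil>t\<rceil>"
    have m: "t \<le> real m" "real m < t + 1" using t by (auto simp: m_def) linarith+
    have m2: "real m \<le> 2 * t"
    proof (cases "t \<le> 1")
      case True
      hence "m = 1" using t by (simp add: m_def ceiling_eq_iff nat_eq_iff)
      then show ?thesis using 2 by simp
    next
      case False
      then show ?thesis using m by linarith
    qed
    hence "m \<le> card M" using 2 by linarith
    then obtain M' where M': "M' \<subseteq> M" "card M' = m" "finite M'"
      by (rule obtain_subset_with_card_n)
    have V': "M' \<subseteq> V" using M' M by blast
    have cS: "real (card (V - M')) = N - real m"
      using M' V' fin card_mono[OF fin V'] cV by (simp add: card_Diff_subset of_nat_diff)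
    have "(\<Sum>v\<in>M'. real (degree_in V E v)) \<le> (\<Sum>v\<in>M'. \<kappa> * N - 4 * t)"
      by (rule sum_mono) (use M' in \<open>auto simp: M_def t_def N_def algebra_simps\<close>)
    hence "\<kappa> * N ^ 2 - 2 * t ^ 2 - 2 * (real m * (\<kappa> * N - 4 * t)) < real (degree_sum (V - M') E)"
      using degree_sum_diff[OF fin V'] D M' by simp
    \<comment> \<open>Expanded, this says \<open>\<kappa> m^2 + 2 t^2 \<le> 8 m t\<close>, a
      consequence of \<open>t \<le> m \<le> 2 t\<close>.\<close>
    moreover have "\<kappa> * (N - real m) ^ 2 \<le> \<kappa> * N ^ 2 - 2 * t ^ 2 - 2 * (real m * (\<kappa> * N - 4 * t))"
    proof -
      have "t * (6 * t) \<le> real m * (8 * t - real m)" using m m2 t by (intro mult_mono) auto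
      hence "6 * (t * t) \<le> 8 * (real m * t) - real m * real m" by (simp add: algebra_simps)
      moreover have "\<kappa> * (real m * real m) \<le> 1 * (real m * real m)"
        using \<kappa> by (intro mult_right_mono) auto
      moreover have "0 \<le> t * t" by simp
      ultimately have "0 \<le> 8 * (real m * t) - 2 * (t * t) - \<kappa> * (real m * real m)" by linarith
      thus ?thesis by (simp add: power2_eq_square algebra_simps)
    qed
    ultimately have "\<kappa> * real (card (V - M')) ^ 2 < real (degree_sum (V - M') E)" unfolding cS by linarith
    moreover have "(1 - 2 * s) * N \<le> real (card (V - M'))"
      unfolding cS using m2 by (simp add: t_def N_def algebra_simps)
    ultimately show ?thesis using J_dense[of "V - M'"] loss by auto
  next
    case 3
    have t2: "2 * t ^ 2 < 1 / 2"
      using mult_strict_mono[of t "1 / 2" t "1 / 2"] t 3 by (simp add: power2_eq_square)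
    have full: "(1 - 1 / (3 * real r ^ 4)) * N \<le> N" using N r4 by (simp add: mult_le_cancel_right1)
    show ?thesis
    proof (cases "\<forall>v\<in>V. (1 - 1 / real r - 1 / real r ^ 4) * N \<le> real (degree_in V E v)")
      case True
      have "?J \<or> (\<exists>f. proper_colouring V E r f)"
        by (rule J_or_colouring) (use True full cV in auto)
      moreover have ?P if col: "proper_colouring V E r f" for f
      proof (rule P[OF order_refl _ col])
        show "(1 - 2 * s) * N \<le> real (card V)" using cV s N by (simp add: mult_le_cancel_right1)
        \<comment> \<open>The number of missing edges plus the variance of the class sizes is less than \<open>1/2\<close>, so both
          vanish by integrality.\<close>
        define a where "a i = real (card {x \<in> V. f x = i})" for i
        have fr: "f v < r" if "v \<in> V" for v using col that by (auto simp: proper_colouring_def)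
        have dle: "real (degree_in V E v) \<le> N - a (f v)" if "v \<in> V" for v
          using degree_le_of_colouring[OF fin col that] cV by (simp add: a_def)
        have eq: "(\<Sum>v\<in>V. N - a (f v)) = \<kappa> * N ^ 2 - (\<Sum>i<r. (a i - N / real r) ^ 2)"
          using degree_sum_of_colouring[OF fin col] r cV by (simp add: a_def \<kappa>_def)
        have defect: "(\<Sum>v\<in>V. N - a (f v) - real (degree_in V E v)) + (\<Sum>i<r. (a i - N / real r) ^ 2) < 1 / 2"
          using eq D t2 by (simp add: sum_subtractf degree_sum_def)
        have defect0: "0 \<le> (\<Sum>v\<in>V. N - a (f v) - real (degree_in V E v))"
          by (rule sum_nonneg) (use dle in force)
        have var: "(\<Sum>i<r. (a i - N / real r) ^ 2) < 1 / 2" using defect defect0 by linarith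
        \<comment> \<open>Two unequal integer sizes differ by at least 1, so their squared distances
          to any common centre add up to at least \<open>1/2\<close>.\<close>
        have same: "a i = a j" if ij: "i < r" "j < r" for i j
        proof (rule ccontr)
          assume ne: "a i \<noteq> a j"
          hence "card {x \<in> V. f x = i} \<noteq> card {x \<in> V. f x = j}" by (auto simp: a_def)
          hence "1 \<le> \<bar>a i - a j\<bar>" unfolding a_def by linarith
          hence "1 \<le> (a i - a j) ^ 2" by (metis one_le_power power2_abs)
          moreover have "(a i - a j) ^ 2 \<le> 2 * ((a i - N / real r) ^ 2 + (a j - N / real r) ^ 2)"
          proof -
            have "(x - y) ^ 2 \<le> 2 * ((x - c) ^ 2 + (y - c) ^ 2)" for x y c :: real
              using zero_le_power2[of "(x - c) + (y - c)"] by (simp add: power2_eq_square algebra_simps)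
            thus ?thesis .
          qed
          moreover have "(\<Sum>k\<in>{i, j}. (a k - N / real r) ^ 2) \<le> (\<Sum>i<r. (a i - N / real r) ^ 2)"
            by (rule sum_mono2) (use ij in auto)
          ultimately show False using var ne by (cases "i = j") auto
        qed
        have ai: "a i = N / real r" if "i < r" for i
        proof -
          have "N = (\<Sum>j<r. a j)"
            using sum_colour_classes[OF fin col, of "\<lambda>_. 1"] cV by (simp add: a_def)
          also have "\<dots> = (\<Sum>j<r. a i)" by (rule sum.cong) (use same[OF _ that] in auto)
          finally show ?thesis using r by simp
        qed
        fix v assume v: "v \<in> V"
        have "N - a (f v) - real (degree_in V E v) \<le> (\<Sum>v\<in>V. N - a (f v) - real (degree_in V E v))"
          by (rule member_le_sum[OF v]) (use dle fin in force)+
        moreover have "0 \<le> (\<Sum>i<r. (a i - N / real r) ^ 2)" by (simp add: sum_nonneg)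
        ultimately have "N - a (f v) - real (degree_in V E v) < 1" using defect by linarith
        hence "real (card V) < real (card {x \<in> V. f x = f v} + degree_in V E v + 1)"
          by (simp add: a_def cV)
        hence "card V \<le> card {x \<in> V. f x = f v} + degree_in V E v" by (simp only: of_nat_less_iff)
        hence "N - a (f v) \<le> real (degree_in V E v)" unfolding a_def cV[symmetric] by linarith
        hence "\<kappa> * N \<le> real (degree_in V E v)" using ai[OF fr[OF v]] by (simp add: \<kappa>_def left_diff_distrib)
        moreover have "0 < 6 * s * N" using s N by simp
        ultimately show "(\<kappa> - 6 * s) * N < real (degree_in V E v)" unfolding left_diff_distrib by linarith
      qed
      ultimately show ?thesis by blast
    next
      case False
      then obtain v where v: "v \<in> V" "real (degree_in V E v) < (\<kappa> - 1 / real r ^ 4) * N"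
        by (auto simp: \<kappa>_def not_le)
      have cS: "real (card (V - {v})) = N - 1"
      proof -
        have "0 < card V" using v fin by (auto simp: card_gt_0_iff)
        thus ?thesis using v fin cV by (simp add: of_nat_diff)
      qed
      \<comment> \<open>Deleting \<open>v\<close> gains at least \<open>2 N / r^4 > 32\<close>,
        against a deficit below \<open>1/2\<close>, so \<open>V - {v}\<close> exceeds the Turan
        density. The same bound makes one vertex a small enough loss of order.\<close>
      have big: "16 < 1 / real r ^ 4 * N" using n4 r by (simp add: less_divide_eq)
      have less: "\<kappa> * N ^ 2 - 2 * t ^ 2 - 2 * ((\<kappa> - 1 / real r ^ 4) * N) < real (degree_sum (V - {v}) E)"
        using degree_sum_diff[OF fin, of "{v}"] D v by simp
      have "\<kappa> * (N - 1) ^ 2 < real (degree_sum (V - {v}) E)"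
      proof -
        have "\<kappa> * (N - 1) ^ 2 = \<kappa> * N ^ 2 - 2 * (\<kappa> * N) + \<kappa>"
          by (simp add: power2_eq_square algebra_simps)
        moreover have "2 * ((\<kappa> - 1 / real r ^ 4) * N) = 2 * (\<kappa> * N) - 2 * (1 / real r ^ 4 * N)"
          by (simp add: left_diff_distrib)
        ultimately show ?thesis using less big t2 \<kappa> by linarith
      qed
      moreover have "(1 - 1 / (3 * real r ^ 4)) * N \<le> N - 1"
      proof -
        have "(1 - 1 / (3 * real r ^ 4)) * N = N - 1 / real r ^ 4 * N / 3"
          by (simp add: left_diff_distrib)
        also have "\<dots> \<le> N - 1" using big by simp
        finally show ?thesis .
      qed
      ultimately have ?J using J_dense[of "V - {v}"] cS by auto
      then show ?thesis ..
    qed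
  qed
qed

end
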